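(* (Gaussian curvature via brackets.) Let $\Sigma$ be a surface ($n=2$) embedded in a Riemannian manifold $(M,\bar g)$ of dimension $m=2+p$. Then the Gaussian curvature $K$ of $\Sigma$ satisfies $$K=\frac{\bar g\big(\bar R(e_1,e_2)e_2,e_1\big)}{g}-\frac{1}{2\gamma^2}\sum_{A=1}^p\operatorname{Tr}\mathcal{S}_A^2 .$$ When $M=\mathbb{R}^m$ (with Cartesian coordinates $x^i$) this becomes $$K=-\frac{1}{2\gamma^2}\sum_{A=1}^p\sum_{i,j=1}^m\{x^i,n_A^j\}\{x^j,n_A^i\},$$ and one also has $$K=-\frac{1}{8\gamma^4(p-1)!}\sum\varepsilon_{jklI}\,\varepsilon_{imnI}\,\{x^i,\{x^k,x^l\}\}\{x^j,\{x^m,x^n\}\},$$ where in the last formula the sum is over all indices $i,j,k,l,m,n$ and all multi-indices $I$ of $p-1$ indices, each index running from $1$ to $2+p$, and $\varepsilon$ is the Levi-Civita symbol of $\mathbb{R}^{2+p}$. In particular, for a surface in $\mathbb{R}^3$ with unit normal $n^i\partial_i$ and $\rho=\sqrt g$, $K=-\frac12\sum_{i,j=1}^3\{x^i,n^j\}\{x^j,n^i\}$.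
   Context: $x^1,\dots,x^{2+p}$ are local coordinates on $M$, $u^1,u^2$ local coordinates on $\Sigma$; the $x^i$ are regarded as functions of $u^1,u^2$ (the embedding), $\partial_a=\partial/\partial u^a$. $p\ge1$. $e_a=(\partial_ax^i)\partial_i$, $g_{ab}=\bar g(e_a,e_b)$, $g=\det(g_{ab})$. $N_A=n_A^i\partial_i$, $A=1,\dots,p$, are (local, smooth) normal vector fields along $\Sigma$ with $\bar g(N_A,N_B)=\delta_{AB}$. $\bar\nabla$ is the Levi-Civita connection of $M$, $(\bar\nabla_aN_A)^i=\partial_an_A^i+\bar\Gamma^i_{jk}(\partial_ax^j)n_A^k$, and $\bar R(X,Y)Z=\bar\nabla_X\bar\nabla_YZ-\bar\nabla_Y\bar\nabla_XZ-\bar\nabla_{[X,Y]}Z$. $\rho$ is an arbitrary non-vanishing density on $\Sigma$, $\{f,h\}=\frac1\rho\varepsilon^{ab}(\partial_af)(\partial_bh)$ with $\varepsilon^{12}=1$, and $\gamma=\sqrt g/\rho$. $\mathcal{S}_A^{ij}=\frac1\rho\varepsilon^{ab}(\partial_ax^i)(\bar\nabla_bN_A)^j$, regarded as a map $TM\to TM$ (at points of $\Sigma$) by lowering the second index with $\bar g$; $\mathcal{S}_A^2$ is its composition with itself and $\operatorname{Tr}$ the trace over $TM$. The Gaussian curvature $K$ is one half of the scalar curvature of the induced metric on $\Sigma$ (equivalently its sectional curvature). *)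

theory Defs
  imports "HOL-Analysis.Analysis" "HOL-Combinatorics.Permutations"
begin

section \<open>Smooth functions of several real variables\<close>

definition pd :: "'n::finite \<Rightarrow> (real^'n \<Rightarrow> 'b::real_normed_vector) \<Rightarrow> real^'n \<Rightarrow> 'b" where
  "pd i f x = frechet_derivative f (at x) (axis i 1)"

text \<open>The following two notions are meant for open sets \<open>U\<close>.\<close>

primrec C_k_on :: "nat \<Rightarrow> (real^'n::finite) set \<Rightarrow> (real^'n \<Rightarrow> 'b::real_normed_vector) \<Rightarrow> bool" where
  "C_k_on 0 U f \<longleftrightarrow> continuous_on U f"
| "C_k_on (Suc k) U f \<longleftrightarrow> f differentiable_on U \<and> (\<forall>i. C_k_on k U (pd i f))"

definition smooth_on :: "(real^'n::finite) set \<Rightarrow> (real^'n \<Rightarrow> 'b::real_normed_vector) \<Rightarrow> bool" where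
  "smooth_on U f \<longleftrightarrow> (\<forall>k. C_k_on k U f)"

section \<open>Levi-Civita connection and curvature in local coordinates\<close>

text \<open>A metric is given in local coordinates by its matrix-valued component function \<open>G\<close>,
  a vector field by its column of components.\<close>

definition metric_at :: "(real^'n::finite \<Rightarrow> real^'n^'n) \<Rightarrow> real^'n \<Rightarrow> real^'n \<Rightarrow> real^'n \<Rightarrow> real" where
  "metric_at G y v w = (\<Sum>i\<in>UNIV. \<Sum>j\<in>UNIV. G y $ i $ j * v $ i * w $ j)"

definition christoffel :: "(real^'n::finite \<Rightarrow> real^'n^'n) \<Rightarrow> 'n \<Rightarrow> 'n \<Rightarrow> 'n \<Rightarrow> real^'n \<Rightarrow> real" where
  "christoffel G i j k y =
     (\<Sum>l\<in>UNIV. matrix_inv (G y) $ i $ l *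
        (pd j (\<lambda>z. G z $ l $ k) y + pd k (\<lambda>z. G z $ l $ j) y - pd l (\<lambda>z. G z $ j $ k) y)) / 2"

definition nabla ::
  "(real^'n::finite \<Rightarrow> real^'n^'n) \<Rightarrow> (real^'n \<Rightarrow> real^'n) \<Rightarrow> (real^'n \<Rightarrow> real^'n) \<Rightarrow> real^'n \<Rightarrow> real^'n" where
  "nabla G X Y y = (\<chi> i. (\<Sum>j\<in>UNIV. X y $ j * pd j (\<lambda>z. Y z $ i) y) +
     (\<Sum>j\<in>UNIV. \<Sum>k\<in>UNIV. christoffel G i j k y * X y $ j * Y y $ k))"

definition lie_bracket ::
  "(real^'n::finite \<Rightarrow> real^'n) \<Rightarrow> (real^'n \<Rightarrow> real^'n) \<Rightarrow> real^'n \<Rightarrow> real^'n" where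
  "lie_bracket X Y y =
     (\<chi> i. \<Sum>j\<in>UNIV. X y $ j * pd j (\<lambda>z. Y z $ i) y - Y y $ j * pd j (\<lambda>z. X z $ i) y)"

definition curvature_field ::
  "(real^'n::finite \<Rightarrow> real^'n^'n) \<Rightarrow> (real^'n \<Rightarrow> real^'n) \<Rightarrow> (real^'n \<Rightarrow> real^'n) \<Rightarrow> (real^'n \<Rightarrow> real^'n)
     \<Rightarrow> real^'n \<Rightarrow> real^'n" where
  "curvature_field G X Y Z y =
     nabla G X (nabla G Y Z) y - nabla G Y (nabla G X Z) y - nabla G (lie_bracket X Y) Z y"

text \<open>\<open>R(X,Y)Z\<close> at a point depends only on the values of \<open>X, Y, Z\<close> there; tangent vectors
  at \<open>y\<close> are extended to fields with constant components.\<close>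

definition curvature ::
  "(real^'n::finite \<Rightarrow> real^'n^'n) \<Rightarrow> real^'n \<Rightarrow> real^'n \<Rightarrow> real^'n \<Rightarrow> real^'n \<Rightarrow> real^'n" where
  "curvature G y v w z = curvature_field G (\<lambda>_. v) (\<lambda>_. w) (\<lambda>_. z) y"

text \<open>\<open>Ric(v,w)\<close> is the trace of \<open>z \<mapsto> R(z,v)w\<close>.\<close>

definition ricci :: "(real^'n::finite \<Rightarrow> real^'n^'n) \<Rightarrow> real^'n \<Rightarrow> real^'n \<Rightarrow> real^'n \<Rightarrow> real" where
  "ricci G y v w = (\<Sum>k\<in>UNIV. curvature G y (axis k 1) v w $ k)"

definition scalar_curvature :: "(real^'n::finite \<Rightarrow> real^'n^'n) \<Rightarrow> real^'n \<Rightarrow> real" where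
  "scalar_curvature G y =
     (\<Sum>i\<in>UNIV. \<Sum>j\<in>UNIV. matrix_inv (G y) $ i $ j * ricci G y (axis i 1) (axis j 1))"

definition gaussian_curvature :: "(real^2 \<Rightarrow> real^2^2) \<Rightarrow> real^2 \<Rightarrow> real" where
  "gaussian_curvature h u = scalar_curvature h u / 2"

section \<open>Riemannian manifolds and embedded surfaces\<close>

type_synonym ('a, 'n) chart = "'a set \<times> ('a \<Rightarrow> real^'n)"

fun chart_inv :: "('a, 'n) chart \<Rightarrow> real^'n \<Rightarrow> 'a" where
  "chart_inv (D, \<phi>) = inv_into D \<phi>"

definition chart_on :: "'a topology \<Rightarrow> ('a, 'n::finite) chart \<Rightarrow> bool" where
  "chart_on X c \<longleftrightarrow> openin X (fst c) \<and> open (snd c ` fst c) \<and>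
     homeomorphic_map (subtopology X (fst c)) (top_of_set (snd c ` fst c)) (snd c)"

definition smooth_manifold :: "'a topology \<Rightarrow> ('a, 'n::finite) chart set \<Rightarrow> bool" where
  "smooth_manifold X \<A> \<longleftrightarrow> Hausdorff_space X \<and> second_countable X \<and>
     \<Union> (fst ` \<A>) = topspace X \<and> (\<forall>c\<in>\<A>. chart_on X c) \<and>
     (\<forall>c\<in>\<A>. \<forall>d\<in>\<A>. smooth_on (snd c ` (fst c \<inter> fst d)) (snd d \<circ> chart_inv c))"

text \<open>A Riemannian metric is given by its components \<open>G c\<close> in each chart \<open>c\<close>, which
  transform as a covariant 2-tensor.\<close>

definition riemannian_metric ::
  "('a, 'n::finite) chart set \<Rightarrow> (('a, 'n) chart \<Rightarrow> real^'n \<Rightarrow> real^'n^'n) \<Rightarrow> bool" where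
  "riemannian_metric \<A> G \<longleftrightarrow>
     (\<forall>c\<in>\<A>. smooth_on (snd c ` fst c) (G c) \<and>
        (\<forall>y\<in>snd c ` fst c. transpose (G c y) = G c y \<and> (\<forall>v. v \<noteq> 0 \<longrightarrow> 0 < metric_at (G c) y v v))) \<and>
     (\<forall>c\<in>\<A>. \<forall>d\<in>\<A>. \<forall>q\<in>fst c \<inter> fst d.
        let J = matrix (frechet_derivative (snd d \<circ> chart_inv c) (at (snd c q)))
        in G c (snd c q) = transpose J ** G d (snd d q) ** J)"

definition coord_dom :: "('s \<Rightarrow> 'a) \<Rightarrow> ('s, 'k::finite) chart \<Rightarrow> ('a, 'n::finite) chart \<Rightarrow> (real^'k) set" where
  "coord_dom f b c = snd b ` {q \<in> fst b. f q \<in> fst c}"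

definition coord_map :: "('s \<Rightarrow> 'a) \<Rightarrow> ('s, 'k::finite) chart \<Rightarrow> ('a, 'n::finite) chart \<Rightarrow> real^'k \<Rightarrow> real^'n" where
  "coord_map f b c = snd c \<circ> f \<circ> chart_inv b"

definition smooth_embedding ::
  "'s topology \<Rightarrow> ('s, 'k::finite) chart set \<Rightarrow> 'a topology \<Rightarrow> ('a, 'n::finite) chart set \<Rightarrow> ('s \<Rightarrow> 'a) \<Rightarrow> bool" where
  "smooth_embedding S \<B> X \<A> f \<longleftrightarrow> embedding_map S X f \<and>
     (\<forall>b\<in>\<B>. \<forall>c\<in>\<A>. smooth_on (coord_dom f b c) (coord_map f b c) \<and>
        (\<forall>u\<in>coord_dom f b c. inj (frechet_derivative (coord_map f b c) (at u))))"

text \<open>The manifold is \<open>\<real>\<^sup>m\<close>, and \<open>c\<close> is the chart of its Cartesian coordinates.\<close>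

definition cartesian_coordinates ::
  "'a topology \<Rightarrow> (('a, 'n::finite) chart \<Rightarrow> real^'n \<Rightarrow> real^'n^'n) \<Rightarrow> ('a, 'n) chart \<Rightarrow> bool" where
  "cartesian_coordinates X G c \<longleftrightarrow>
     fst c = topspace X \<and> snd c ` fst c = UNIV \<and> (\<forall>y. G c y = mat 1)"

section \<open>A surface in local coordinates\<close>

text \<open>Here \<open>G\<close> is the ambient metric in local coordinates, \<open>x\<close> the embedding
  in local coordinates, \<open>\<rho>\<close> the density and \<open>N\<close> a normal vector field along the surface.\<close>

definition induced_metric ::
  "(real^'m::finite \<Rightarrow> real^'m^'m) \<Rightarrow> (real^2 \<Rightarrow> real^'m) \<Rightarrow> real^2 \<Rightarrow> real^2^2" where
  "induced_metric G x u = (\<chi> a b. metric_at G (x u) (pd a x u) (pd b x u))"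

definition normal_frame ::
  "(real^'m::finite \<Rightarrow> real^'m^'m) \<Rightarrow> (real^2 \<Rightarrow> real^'m) \<Rightarrow> (real^2) set \<Rightarrow> ('p \<Rightarrow> real^2 \<Rightarrow> real^'m) \<Rightarrow> bool" where
  "normal_frame G x W N \<longleftrightarrow> (\<forall>A. smooth_on W (N A)) \<and>
     (\<forall>u\<in>W. \<forall>A. (\<forall>a. metric_at G (x u) (N A u) (pd a x u) = 0) \<and>
        (\<forall>B. metric_at G (x u) (N A u) (N B u) = (if A = B then 1 else 0)))"

definition nabla_along ::
  "(real^'m::finite \<Rightarrow> real^'m^'m) \<Rightarrow> (real^2 \<Rightarrow> real^'m) \<Rightarrow> 2 \<Rightarrow> (real^2 \<Rightarrow> real^'m) \<Rightarrow> real^2 \<Rightarrow> real^'m" where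
  "nabla_along G x a N u = (\<chi> i. pd a (\<lambda>v. N v $ i) u +
     (\<Sum>j\<in>UNIV. \<Sum>k\<in>UNIV. christoffel G i j k (x u) * pd a (\<lambda>v. x v $ j) u * N u $ k))"

definition eps2 :: "2 \<Rightarrow> 2 \<Rightarrow> real" where
  "eps2 a b = (if a = 1 \<and> b = 2 then 1 else if a = 2 \<and> b = 1 then -1 else 0)"

definition poisson :: "(real^2 \<Rightarrow> real) \<Rightarrow> (real^2 \<Rightarrow> real) \<Rightarrow> (real^2 \<Rightarrow> real) \<Rightarrow> real^2 \<Rightarrow> real" where
  "poisson \<rho> f h u = 1 / \<rho> u * (\<Sum>a\<in>UNIV. \<Sum>b\<in>UNIV. eps2 a b * pd a f u * pd b h u)"

definition S_up ::
  "(real^'m::finite \<Rightarrow> real^'m^'m) \<Rightarrow> (real^2 \<Rightarrow> real^'m) \<Rightarrow> (real^2 \<Rightarrow> real) \<Rightarrow> (real^2 \<Rightarrow> real^'m)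
     \<Rightarrow> real^2 \<Rightarrow> real^'m^'m" where
  "S_up G x \<rho> N u = (\<chi> i j. 1 / \<rho> u * (\<Sum>a\<in>UNIV. \<Sum>b\<in>UNIV.
     eps2 a b * pd a (\<lambda>v. x v $ i) u * nabla_along G x b N u $ j))"

definition S_map ::
  "(real^'m::finite \<Rightarrow> real^'m^'m) \<Rightarrow> (real^2 \<Rightarrow> real^'m) \<Rightarrow> (real^2 \<Rightarrow> real) \<Rightarrow> (real^2 \<Rightarrow> real^'m)
     \<Rightarrow> real^2 \<Rightarrow> real^'m^'m" where
  "S_map G x \<rho> N u = (\<chi> i k. \<Sum>j\<in>UNIV. S_up G x \<rho> N u $ i $ j * G (x u) $ j $ k)"

definition gamma_factor ::
  "(real^'m::finite \<Rightarrow> real^'m^'m) \<Rightarrow> (real^2 \<Rightarrow> real^'m) \<Rightarrow> (real^2 \<Rightarrow> real) \<Rightarrow> real^2 \<Rightarrow> real" where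
  "gamma_factor G x \<rho> u = sqrt (det (induced_metric G x u)) / \<rho> u"

text \<open>The Levi-Civita symbol of a list of as many indices as there are elements of the index
  type. Since \<open>i\<close> is preceded by \<open>card {y. y < i}\<close> indices, the function below sends
  the \<open>k\<close>-th index to the \<open>k\<close>-th entry of the list.\<close>

definition levi_civita :: "'m::{finite,linorder} list \<Rightarrow> real" where
  "levi_civita xs = (let \<sigma> = (\<lambda>i. xs ! card {y. y < i})
     in if \<sigma> permutes UNIV then of_int (sign \<sigma>) else 0)"

end

theory Submission
  imports Defs
begin

text \<open>
  The proof runs the Gauss equation for an immersion \<open>x\<close> in a form that makes the intrinsic and the
  extrinsic side two instances of one computation. For vector fields along \<open>x\<close> the covariant
  derivative \<open>covd\<close> is compatible with the metric, torsion free on the coordinate fields \<open>e\<^sub>a\<close>, and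
  its commutator is the curvature of the ambient space. These three facts alone give
  \[ \langle R(e_1,e_2)e_2,e_1\rangle = \partial_1\Gamma_{221} - \partial_2\Gamma_{121}
      - \langle D_1e_1,D_2e_2\rangle + |D_1e_2|^2 , \]
  where \<open>\<Gamma>\<close> are the Christoffel symbols of the first kind of the induced metric (Koszul's formula,
  lemma \<open>koszul\<close>). The same identity holds for the identity map of the parameter
  domain with the induced metric as ambient metric, and there its left-hand side is \<open>K\<close> times the
  determinant of the metric. Subtracting the two instances cancels the \<open>\<Gamma>\<close> terms,
  and what remains is the inner product of the normal parts of \<open>D\<^sub>ae\<^sub>b\<close>: this is \<open>gauss_equation\<close>.

  The inner product of normal parts is written as a Gram
  determinant, which is then resolved in two ways. With an orthonormal normal frame it is
  the sum over \<open>A\<close> of the products of the second fundamental forms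
  \<open>\<langle>D\<^sub>ae\<^sub>b,N\<^sub>A\<rangle> = -\<langle>e\<^sub>b,D\<^sub>aN\<^sub>A\<rangle>\<close>, and since each \<open>\<S>\<^sub>A\<close> is a difference of two rank-one maps, the trace of
  its square is \<open>-2/\<rho>\<^sup>2\<close> times the determinant of the second fundamental form; this gives the first
  formula, and for a constant metric the second and the last. In flat space the
  vectors \<open>Z\<^sub>I\<^sup>j = \<epsilon>\<^bsub>jklI\<^esub>{x\<^sup>k,x\<^sup>l}\<close>, one for each multi-index \<open>I\<close>, are normal to the surface and behave like an
  over-complete normal frame: the contraction of two Levi-Civita symbols turns
  \<open>\<Sum>\<^sub>I \<langle>Z\<^sub>I,v\<rangle>\<langle>Z\<^sub>I,w\<rangle>\<close> into the same Gram determinant, and the same trace computation applied to \<open>Z\<^sub>I\<close> in place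
  of \<open>N\<^sub>A\<close> yields the formula with nested brackets, which involves only the embedding and the density.
\<close>

section \<open>Calculus of the smoothness predicate and of partial derivatives\<close>

lemma pd_has_derivative:
  "(f has_derivative f') (at x) \<Longrightarrow> pd i f x = f' (axis i 1)"
  by (simp add: pd_def frechet_derivative_at[symmetric])

lemma pd_const [simp]: "pd i (\<lambda>_. c) x = 0"
  by (rule pd_has_derivative[OF has_derivative_const])

lemma pd_bounded_linear:
  assumes "bounded_linear h" "f differentiable at x"
  shows "pd i (\<lambda>x. h (f x)) x = h (pd i f x)"
  unfolding pd_def
  using bounded_linear.has_derivative[OF assms(1) assms(2)[unfolded frechet_derivative_works]]
  by (simp add: frechet_derivative_at[symmetric])

lemma pd_vec_nth: "f differentiable at x \<Longrightarrow> pd i (\<lambda>x. f x $ j) x = pd i f x $ j"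
  by (rule pd_bounded_linear[OF bounded_linear_vec_nth])

lemma pd_bilinear:
  assumes "bounded_bilinear bop" "f differentiable at x" "g differentiable at x"
  shows "pd i (\<lambda>x. bop (f x) (g x)) x = bop (f x) (pd i g x) + bop (pd i f x) (g x)"
  unfolding pd_def
  using bounded_bilinear.FDERIV[OF assms(1) assms(2,3)[unfolded frechet_derivative_works]]
  by (simp add: frechet_derivative_at[symmetric])

lemma differentiable_bilinear:
  assumes "bounded_bilinear bop" "f differentiable at x" "g differentiable at x"
  shows "(\<lambda>x. bop (f x) (g x)) differentiable at x"
  using bounded_bilinear.FDERIV[OF assms(1) assms(2,3)[unfolded frechet_derivative_works]]
  by (auto simp: differentiable_def)

lemma pd_add:
  assumes "f differentiable at x" "g differentiable at x"
  shows "pd i (\<lambda>x. f x + g x) x = pd i f x + pd i g x"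
  unfolding pd_def
  using has_derivative_add[OF assms[unfolded frechet_derivative_works]]
  by (simp add: frechet_derivative_at[symmetric])

lemma pd_sum:
  assumes "\<And>j. j \<in> I \<Longrightarrow> f j differentiable at x"
  shows "pd i (\<lambda>x. \<Sum>j\<in>I. f j x) x = (\<Sum>j\<in>I. pd i (f j) x)"
proof -
  have "((\<lambda>x. \<Sum>j\<in>I. f j x) has_derivative (\<lambda>v. \<Sum>j\<in>I. frechet_derivative (f j) (at x) v)) (at x)"
    using assms by (intro has_derivative_sum) (simp add: frechet_derivative_works)
  from pd_has_derivative[OF this] show ?thesis by (simp add: pd_def)
qed

lemma frechet_eq_sum_pd:
  assumes "f differentiable at x"
  shows "frechet_derivative f (at x) v = (\<Sum>j\<in>UNIV. v $ j *\<^sub>R pd j f x)"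
proof -
  have l: "linear (frechet_derivative f (at x))"
    using assms by (rule linear_frechet_derivative)
  have "v = (\<Sum>j\<in>UNIV. v $ j *\<^sub>R axis j 1)"
    using basis_expansion[of v] by (simp add: scalar_mult_eq_scaleR)
  then have "frechet_derivative f (at x) v = frechet_derivative f (at x) (\<Sum>j\<in>UNIV. v $ j *\<^sub>R axis j 1)"
    by simp
  also have "\<dots> = (\<Sum>j\<in>UNIV. v $ j *\<^sub>R pd j f x)"
    by (simp add: linear_sum[OF l] linear_cmul[OF l] pd_def)
  finally show ?thesis .
qed

lemma pd_compose:
  assumes "f differentiable at x" "g differentiable at (f x)"
  shows "pd i (\<lambda>x. g (f x)) x = frechet_derivative g (at (f x)) (pd i f x)"
  unfolding pd_def
  using diff_chain_at[OF assms[unfolded frechet_derivative_works]]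
  by (simp add: frechet_derivative_at[symmetric] o_def)

lemma pd_cong:
  assumes "open U" "x \<in> U" "\<And>y. y \<in> U \<Longrightarrow> f y = g y" "f differentiable at x"
  shows "pd i f x = pd i g x"
  unfolding pd_def using frechet_derivative_transform_within_open[OF assms(4,1,2,3)] by simp

lemma differentiable_on_openD:
  "f differentiable_on U \<Longrightarrow> open U \<Longrightarrow> x \<in> U \<Longrightarrow> f differentiable at x"
  by (simp add: differentiable_on_eq_differentiable_at)

lemma C_k_on_cong:
  assumes "open U" "\<And>x. x \<in> U \<Longrightarrow> f x = g x" "C_k_on k U f"
  shows "C_k_on k U g"
  using assms(2,3)
proof (induction k arbitrary: f g)
  case 0
  then show ?case using continuous_on_cong[of U U f g] by auto
next
  case (Suc k)
  have "g differentiable_on U"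
    using Suc.prems by (simp add: differentiable_on_def)
      (metis (no_types, lifting) differentiable_transform_within zero_less_one)
  moreover have "C_k_on k U (pd i g)" for i
  proof (rule Suc.IH)
    show "C_k_on k U (pd i f)" using Suc.prems by simp
    show "pd i f x = pd i g x" if "x \<in> U" for x
      using Suc.prems that assms(1) by (intro pd_cong[of U]) (auto dest: differentiable_on_openD)
  qed
  ultimately show ?case by simp
qed

lemma C_k_on_subset:
  "C_k_on k U f \<Longrightarrow> W \<subseteq> U \<Longrightarrow> C_k_on k W f"
  by (induction k arbitrary: f) (auto intro: continuous_on_subset differentiable_on_subset)

lemma C_k_on_Suc_imp: "C_k_on (Suc k) U f \<Longrightarrow> C_k_on k U f"
  by (induction k arbitrary: f) (auto intro: differentiable_imp_continuous_on)

lemma C_k_on_const: "C_k_on k U (\<lambda>_. c)"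
proof (induction k arbitrary: c)
  case (Suc k)
  have "pd i (\<lambda>_::real^'a. c) = (\<lambda>_. 0)" for i by auto
  with Suc show ?case by simp
qed simp

lemma C_k_on_add:
  assumes "open U" "C_k_on k U f" "C_k_on k U g"
  shows "C_k_on k U (\<lambda>x. f x + g x)"
  using assms(2,3)
proof (induction k arbitrary: f g)
  case 0
  then show ?case by (auto intro: continuous_intros)
next
  case (Suc k)
  then have d: "f differentiable_on U" "g differentiable_on U" by auto
  have "C_k_on k U (pd i (\<lambda>x. f x + g x))" for i
    by (rule C_k_on_cong[OF assms(1), of "\<lambda>x. pd i f x + pd i g x"])
      (use Suc d assms(1) in \<open>auto simp: pd_add differentiable_on_openD\<close>)
  with d show ?case by (auto intro: derivative_intros)
qed

lemma C_k_on_sum: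
  assumes "open U" "\<And>j. j \<in> I \<Longrightarrow> C_k_on k U (f j)"
  shows "C_k_on k U (\<lambda>x. \<Sum>j\<in>I. f j x)"
  using assms(2)
  by (induction I rule: infinite_finite_induct) (auto intro: C_k_on_const C_k_on_add[OF assms(1)])

lemma C_k_on_bilinear:
  assumes "open U" "bounded_bilinear bop" "C_k_on k U f" "C_k_on k U g"
  shows "C_k_on k U (\<lambda>x. bop (f x) (g x))"
  using assms(3,4)
proof (induction k arbitrary: f g)
  case 0
  then show ?case by (simp add: bounded_bilinear.continuous_on[OF assms(2)])
next
  case (Suc k)
  then have d: "f differentiable_on U" "g differentiable_on U" by auto
  have "C_k_on k U (pd i (\<lambda>x. bop (f x) (g x)))" for i
  proof (rule C_k_on_cong[OF assms(1), of "\<lambda>x. bop (f x) (pd i g x) + bop (pd i f x) (g x)"])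
    show "C_k_on k U (\<lambda>x. bop (f x) (pd i g x) + bop (pd i f x) (g x))"
      using Suc C_k_on_Suc_imp[OF Suc.prems(1)] C_k_on_Suc_imp[OF Suc.prems(2)]
      by (intro C_k_on_add assms Suc.IH) auto
  qed (use d assms(1,2) in \<open>simp add: pd_bilinear differentiable_on_openD\<close>)
  moreover have "(\<lambda>x. bop (f x) (g x)) differentiable_on U"
    using d assms(1,2) by (auto simp: differentiable_on_eq_differentiable_at differentiable_bilinear)
  ultimately show ?case by simp
qed

lemma C_k_on_linear:
  assumes "open U" "bounded_linear h" "C_k_on k U f"
  shows "C_k_on k U (\<lambda>x. h (f x))"
  using assms(3)
proof (induction k arbitrary: f)
  case 0
  then show ?case by (simp add: bounded_linear.continuous_on[OF assms(2)])
next
  case (Suc k)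
  then have d: "f differentiable_on U" by auto
  have "C_k_on k U (pd i (\<lambda>x. h (f x)))" for i
    by (rule C_k_on_cong[OF assms(1), of "\<lambda>x. h (pd i f x)"])
      (use Suc d assms(1,2) in \<open>auto simp: pd_bounded_linear differentiable_on_openD\<close>)
  moreover have "(\<lambda>x. h (f x)) differentiable_on U"
    using d assms(1,2)
    by (auto simp: differentiable_on_eq_differentiable_at differentiable_compose bounded_linear_imp_differentiable)
  ultimately show ?case by simp
qed

lemma C_k_on_compose:
  fixes f :: "real^'n::finite \<Rightarrow> real^'m::finite"
  assumes "open U" "open V" "f ` U \<subseteq> V" "C_k_on k U f" "C_k_on k V g"
  shows "C_k_on k U (\<lambda>x. g (f x))"
  using assms(4,5)
proof (induction k arbitrary: g)
  case 0
  then show ?case using assms(3) by (auto intro: continuous_on_compose2)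
next
  case (Suc k)
  then have d: "f differentiable_on U" "g differentiable_on V" by auto
  have dx: "f differentiable at x" "g differentiable at (f x)" if "x \<in> U" for x
    using d assms(1-3) that by (auto intro: differentiable_on_openD)
  have "C_k_on k U (pd i (\<lambda>x. g (f x)))" for i
  proof (rule C_k_on_cong[OF assms(1), of "\<lambda>x. \<Sum>j\<in>UNIV. pd i f x $ j *\<^sub>R pd j g (f x)"])
    show "C_k_on k U (\<lambda>x. \<Sum>j\<in>UNIV. pd i f x $ j *\<^sub>R pd j g (f x))"
      using Suc C_k_on_Suc_imp[OF Suc.prems(1)]
      by (intro C_k_on_sum C_k_on_bilinear[OF _ bounded_bilinear_scaleR]
          C_k_on_linear[OF _ bounded_linear_vec_nth] assms Suc.IH) auto
  qed (use dx in \<open>auto simp: pd_compose frechet_eq_sum_pd\<close>)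
  moreover have "(\<lambda>x. g (f x)) differentiable_on U"
    using dx assms(1)
    by (auto simp: differentiable_on_eq_differentiable_at intro: differentiable_compose)
  ultimately show ?case by simp
qed

lemma smooth_on_differentiable: "smooth_on U f \<Longrightarrow> open U \<Longrightarrow> x \<in> U \<Longrightarrow> f differentiable at x"
  unfolding smooth_on_def by (metis C_k_on.simps(2) differentiable_on_openD)

lemma smooth_on_pd: "smooth_on U f \<Longrightarrow> smooth_on U (pd i f)"
  unfolding smooth_on_def by (metis C_k_on.simps(2))

lemma smooth_on_subset: "smooth_on U f \<Longrightarrow> W \<subseteq> U \<Longrightarrow> smooth_on W f"
  unfolding smooth_on_def by (blast intro: C_k_on_subset)

lemma smooth_on_const: "smooth_on U (\<lambda>_. c)"
  by (simp add: smooth_on_def C_k_on_const)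

lemma smooth_on_bilinear:
  "bounded_bilinear bop \<Longrightarrow> open U \<Longrightarrow> smooth_on U f \<Longrightarrow> smooth_on U g \<Longrightarrow>
    smooth_on U (\<lambda>x. bop (f x) (g x))"
  by (simp add: smooth_on_def C_k_on_bilinear)

lemma smooth_on_linear:
  "bounded_linear h \<Longrightarrow> open U \<Longrightarrow> smooth_on U f \<Longrightarrow> smooth_on U (\<lambda>x. h (f x))"
  by (simp add: smooth_on_def C_k_on_linear)

lemma smooth_on_vec_nth: "open U \<Longrightarrow> smooth_on U f \<Longrightarrow> smooth_on U (\<lambda>x. f x $ i)"
  by (rule smooth_on_linear[OF bounded_linear_vec_nth])

lemma smooth_on_compose:
  fixes f :: "real^'n::finite \<Rightarrow> real^'m::finite"
  shows "open U \<Longrightarrow> open V \<Longrightarrow> f ` U \<subseteq> V \<Longrightarrow> smooth_on U f \<Longrightarrow> smooth_on V g \<Longrightarrow>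
    smooth_on U (\<lambda>x. g (f x))"
  by (simp add: smooth_on_def C_k_on_compose)

lemma pd_id: "pd i (\<lambda>x. x) u = axis i 1"
  by (rule pd_has_derivative) (rule has_derivative_ident)

lemma smooth_on_id: "smooth_on U (\<lambda>x::real^'n::finite. x)"
  unfolding smooth_on_def
proof
  have "pd i (\<lambda>x::real^'n. x) = (\<lambda>_. axis i 1)" for i by (rule ext) (rule pd_id)
  then show "C_k_on k U (\<lambda>x. x)" for k by (cases k) (auto simp: C_k_on_const)
qed

lemma smooth_on_vec_lambda:
  fixes f :: "'m::finite \<Rightarrow> real^'n::finite \<Rightarrow> 'b::euclidean_space"
  assumes "open U" "\<And>i. smooth_on U (f i)"
  shows "smooth_on U (\<lambda>x. \<chi> i. f i x)"
proof -
  have *: "bounded_linear (\<lambda>b::'b. \<chi> j. if j = i then b else 0)" for i :: 'm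
    by (simp add: linear_conv_bounded_linear[symmetric], unfold_locales) (auto simp: vec_eq_iff)
  have "(\<lambda>x. \<chi> i. f i x) = (\<lambda>x. \<Sum>i\<in>UNIV. \<chi> j. if j = i then f i x else 0)"
    by (auto simp: vec_eq_iff)
  with smooth_on_linear[OF * assms] show ?thesis
    by (auto simp: smooth_on_def intro!: C_k_on_sum assms)
qed

lemma has_real_derivative_line:
  fixes f :: "real^'n::finite \<Rightarrow> real"
  assumes "f differentiable at (v + t *\<^sub>R axis a 1)"
  shows "((\<lambda>t. f (v + t *\<^sub>R axis a 1)) has_real_derivative pd a f (v + t *\<^sub>R axis a 1)) (at t)"
proof -
  have "((\<lambda>t::real. v + t *\<^sub>R axis a 1) has_derivative (\<lambda>t. t *\<^sub>R axis a 1)) (at t)"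
    by (auto intro!: derivative_eq_intros)
  from diff_chain_at[OF this assms[unfolded frechet_derivative_works]]
  show ?thesis
    using linear_cmul[OF linear_frechet_derivative[OF assms]]
    by (simp add: has_field_derivative_def o_def pd_def mult_commute_abs)
qed

text \<open>Two applications of the mean value theorem. The second difference is symmetric in the two
  directions while the right-hand side is not, whence \<open>pd_commute_real\<close>.\<close>
lemma second_difference:
  fixes f :: "real^'n::finite \<Rightarrow> real"
  assumes s: "s > 0"
    and box: "\<And>t r. 0 \<le> t \<Longrightarrow> t \<le> s \<Longrightarrow> 0 \<le> r \<Longrightarrow> r \<le> s \<Longrightarrow> u + t *\<^sub>R axis a 1 + r *\<^sub>R axis b 1 \<in> U"
    and d: "\<And>y. y \<in> U \<Longrightarrow> f differentiable at y" "\<And>y. y \<in> U \<Longrightarrow> pd a f differentiable at y"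
  shows "\<exists>t r. 0 \<le> t \<and> t \<le> s \<and> 0 \<le> r \<and> r \<le> s \<and>
    f (u + s *\<^sub>R axis a 1 + s *\<^sub>R axis b 1) - f (u + s *\<^sub>R axis a 1) - f (u + s *\<^sub>R axis b 1) + f u
      = s\<^sup>2 * pd b (pd a f) (u + t *\<^sub>R axis a 1 + r *\<^sub>R axis b 1)"
proof -
  have sw: "u + s *\<^sub>R axis b 1 + t *\<^sub>R axis a 1 = u + t *\<^sub>R axis a 1 + s *\<^sub>R axis b 1" for t
    by simp
  have in1: "u + t *\<^sub>R axis a 1 \<in> U" if "0 \<le> t" "t \<le> s" for t using box[of t 0] that s by simp
  have "\<exists>t. t > 0 \<and> t < s \<and>
     (f (u + s *\<^sub>R axis b 1 + s *\<^sub>R axis a 1) - f (u + s *\<^sub>R axis a 1))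
      - (f (u + s *\<^sub>R axis b 1 + 0 *\<^sub>R axis a 1) - f (u + 0 *\<^sub>R axis a 1))
     = (s - 0) * (pd a f (u + s *\<^sub>R axis b 1 + t *\<^sub>R axis a 1) - pd a f (u + t *\<^sub>R axis a 1))"
    using s box in1 by (intro MVT2 DERIV_diff has_real_derivative_line d) (auto simp: sw)
  then obtain t where t: "t > 0" "t < s" and e1:
    "f (u + s *\<^sub>R axis a 1 + s *\<^sub>R axis b 1) - f (u + s *\<^sub>R axis a 1) - f (u + s *\<^sub>R axis b 1) + f u
     = s * (pd a f (u + t *\<^sub>R axis a 1 + s *\<^sub>R axis b 1) - pd a f (u + t *\<^sub>R axis a 1))"
    by (auto simp: sw)
  have "\<exists>r. r > 0 \<and> r < s \<and>
     pd a f (u + t *\<^sub>R axis a 1 + s *\<^sub>R axis b 1) - pd a f (u + t *\<^sub>R axis a 1 + 0 *\<^sub>R axis b 1)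
     = (s - 0) * pd b (pd a f) (u + t *\<^sub>R axis a 1 + r *\<^sub>R axis b 1)"
    using s t box by (intro MVT2 has_real_derivative_line d) auto
  then obtain r where "r > 0" "r < s"
     "pd a f (u + t *\<^sub>R axis a 1 + s *\<^sub>R axis b 1) - pd a f (u + t *\<^sub>R axis a 1)
     = s * pd b (pd a f) (u + t *\<^sub>R axis a 1 + r *\<^sub>R axis b 1)" by auto
  with t e1 show ?thesis by (intro exI[of _ t] exI[of _ r]) (auto simp: power2_eq_square)
qed

lemma pd_commute_real:
  fixes f :: "real^'n::finite \<Rightarrow> real"
  assumes "open U" "u \<in> U" "smooth_on U f"
  shows "pd a (pd b f) u = pd b (pd a f) u"
proof (rule ccontr)
  assume ne: "pd a (pd b f) u \<noteq> pd b (pd a f) u"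
  define e where "e = \<bar>pd a (pd b f) u - pd b (pd a f) u\<bar> / 2"
  have e: "e > 0" using ne by (simp add: e_def)
  have c: "continuous (at u) (pd i (pd j f))" for i j
    using assms smooth_on_pd[OF smooth_on_pd[OF assms(3)]]
    by (intro differentiable_imp_continuous_within smooth_on_differentiable) auto
  obtain d1 where d1: "d1 > 0" "\<And>y. dist y u < d1 \<Longrightarrow> \<bar>pd a (pd b f) y - pd a (pd b f) u\<bar> < e"
    using c[of a b] e unfolding continuous_at_eps_delta dist_real_def by meson
  obtain d2 where d2: "d2 > 0" "\<And>y. dist y u < d2 \<Longrightarrow> \<bar>pd b (pd a f) y - pd b (pd a f) u\<bar> < e"
    using c[of b a] e unfolding continuous_at_eps_delta dist_real_def by meson
  obtain d3 where d3: "d3 > 0" "ball u d3 \<subseteq> U" using assms openE by blast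
  define s where "s = min d1 (min d2 d3) / 3"
  have s: "s > 0" using d1 d2 d3 by (simp add: s_def)
  have near: "dist (u + t *\<^sub>R axis i 1 + r *\<^sub>R axis j 1) u < min d1 (min d2 d3)"
    if "0 \<le> t" "t \<le> s" "0 \<le> r" "r \<le> s" for t r i j
  proof -
    have "dist (u + t *\<^sub>R axis i 1 + r *\<^sub>R axis j 1) u = norm (t *\<^sub>R axis i 1 + r *\<^sub>R axis j (1::real))"
      by (simp add: dist_norm add.assoc)
    also have "\<dots> \<le> norm (t *\<^sub>R axis i (1::real)) + norm (r *\<^sub>R axis j (1::real))"
      by (rule norm_triangle_ineq)
    also have "\<dots> \<le> s + s" using that by (simp add: norm_axis_1)
    also have "\<dots> < min d1 (min d2 d3)" using s unfolding s_def by linarith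
    finally show ?thesis .
  qed
  have box: "u + t *\<^sub>R axis i 1 + r *\<^sub>R axis j 1 \<in> U"
    if "0 \<le> t" "t \<le> s" "0 \<le> r" "r \<le> s" for t r i j
    using near[OF that, of i j] d3 by (auto simp: dist_commute subset_iff)
  have d: "f differentiable at y" "pd i f differentiable at y" if "y \<in> U" for y i
    using assms that smooth_on_pd[OF assms(3)] by (auto intro: smooth_on_differentiable)
  obtain t r where 1: "0 \<le> t" "t \<le> s" "0 \<le> r" "r \<le> s"
    "f (u + s *\<^sub>R axis a 1 + s *\<^sub>R axis b 1) - f (u + s *\<^sub>R axis a 1) - f (u + s *\<^sub>R axis b 1) + f u
      = s\<^sup>2 * pd b (pd a f) (u + t *\<^sub>R axis a 1 + r *\<^sub>R axis b 1)"
    using second_difference[OF s, of u a b U f] box d by blast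
  obtain t' r' where 2: "0 \<le> t'" "t' \<le> s" "0 \<le> r'" "r' \<le> s"
    "f (u + s *\<^sub>R axis b 1 + s *\<^sub>R axis a 1) - f (u + s *\<^sub>R axis b 1) - f (u + s *\<^sub>R axis a 1) + f u
      = s\<^sup>2 * pd a (pd b f) (u + t' *\<^sub>R axis b 1 + r' *\<^sub>R axis a 1)"
    using second_difference[OF s, of u b a U f] box d by blast
  have swap: "u + s *\<^sub>R axis a 1 + s *\<^sub>R axis b 1 = u + s *\<^sub>R axis b 1 + s *\<^sub>R axis a (1::real)" by simp
  have "p - q - r + w = R \<Longrightarrow> p - r - q + w = R' \<Longrightarrow> R = R'" for p q r w R R' :: real by linarith
  from this[OF 1(5)[unfolded swap] 2(5)]
  have "s\<^sup>2 * pd b (pd a f) (u + t *\<^sub>R axis a 1 + r *\<^sub>R axis b 1)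
    = s\<^sup>2 * pd a (pd b f) (u + t' *\<^sub>R axis b 1 + r' *\<^sub>R axis a 1)" .
  then have "pd b (pd a f) (u + t *\<^sub>R axis a 1 + r *\<^sub>R axis b 1)
    = pd a (pd b f) (u + t' *\<^sub>R axis b 1 + r' *\<^sub>R axis a 1)" using s by simp
  moreover note d2(2)[of "u + t *\<^sub>R axis a 1 + r *\<^sub>R axis b 1"] d1(2)[of "u + t' *\<^sub>R axis b 1 + r' *\<^sub>R axis a 1"]
    near[OF 1(1-4), of a b] near[OF 2(1-4), of b a]
  ultimately show False unfolding e_def by (auto simp: field_simps abs_if split: if_splits)
qed

lemma pd_commute:
  fixes f :: "real^'n::finite \<Rightarrow> real^'m::finite"
  assumes "open U" "u \<in> U" "smooth_on U f"
  shows "pd a (pd b f) u = pd b (pd a f) u"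
proof -
  have *: "pd a (pd b f) u $ i = pd a (pd b (\<lambda>v. f v $ i)) u" for a b i
  proof -
    have "pd a (pd b f) u $ i = pd a (\<lambda>v. pd b f v $ i) u"
      by (rule pd_vec_nth[symmetric], rule smooth_on_differentiable[of U])
        (use assms in \<open>auto intro: smooth_on_pd\<close>)
    also have "\<dots> = pd a (pd b (\<lambda>v. f v $ i)) u"
      using assms
      by (intro pd_cong[of U] pd_vec_nth[symmetric] smooth_on_differentiable[of U] smooth_on_pd
          smooth_on_vec_nth)
    finally show ?thesis .
  qed
  show ?thesis
    by (auto simp: vec_eq_iff * intro!: pd_commute_real[of U] assms smooth_on_vec_nth)
qed

section \<open>The Levi-Civita connection of a coordinate patch\<close>

lemma bounded_bilinear_matrix_vector:
  "bounded_bilinear (\<lambda>(M::real^'n::finite^'m::finite) v. M *v v)"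
  unfolding bilinear_conv_bounded_bilinear[symmetric] bilinear_def
  by (auto intro!: linearI simp: matrix_vector_mult_add_rdistrib matrix_vector_right_distrib
      scaleR_matrix_vector_assoc matrix_vector_mult_scaleR)

lemma smooth_on_quadratic:
  fixes M :: "real^'k::finite \<Rightarrow> real^'n::finite^'m::finite"
  assumes "open U" "smooth_on U M" "smooth_on U v" "smooth_on U w"
  shows "smooth_on U (\<lambda>x. v x \<bullet> (M x *v w x))"
  by (intro smooth_on_bilinear[OF bounded_bilinear_inner] smooth_on_bilinear[OF bounded_bilinear_matrix_vector] assms)

lemma differentiable_quadratic:
  fixes M :: "real^'k::finite \<Rightarrow> real^'n::finite^'m::finite"
  assumes "M differentiable at x" "v differentiable at x" "w differentiable at x"
  shows "(\<lambda>x. v x \<bullet> (M x *v w x)) differentiable at x"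
  by (intro differentiable_bilinear[OF bounded_bilinear_inner]
      differentiable_bilinear[OF bounded_bilinear_matrix_vector] assms)

lemma pd_quadratic:
  fixes M :: "real^'k::finite \<Rightarrow> real^'n::finite^'m::finite"
  assumes "M differentiable at x" "v differentiable at x" "w differentiable at x"
  shows "pd a (\<lambda>x. v x \<bullet> (M x *v w x)) x =
    v x \<bullet> (M x *v pd a w x) + v x \<bullet> (pd a M x *v w x) + pd a v x \<bullet> (M x *v w x)"
  using assms
  by (simp add: pd_bilinear[OF bounded_bilinear_inner] pd_bilinear[OF bounded_bilinear_matrix_vector]
      differentiable_bilinear[OF bounded_bilinear_matrix_vector] inner_add_right)

lemma inner_matrix_sym:
  fixes M :: "real^'n::finite^'n"
  shows "transpose M = M \<Longrightarrow> v \<bullet> (M *v w) = w \<bullet> (M *v v)"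
  by (metis dot_lmul_matrix inner_commute vector_transpose_matrix)

lemma inner_matrix_sum:
  fixes M :: "'i \<Rightarrow> real^'n::finite^'m::finite"
  shows "v \<bullet> ((\<Sum>j\<in>I. c j *\<^sub>R M j) *v w) = (\<Sum>j\<in>I. c j * (v \<bullet> (M j *v w)))"
proof -
  have "linear (\<lambda>A. v \<bullet> (A *v w))"
    by (intro linearI) (simp_all add: matrix_vector_mult_add_rdistrib inner_add_right scaleR_matrix_vector_assoc[symmetric])
  from linear_sum[OF this, of "\<lambda>j. c j *\<^sub>R M j" I] show ?thesis
    by (simp add: scaleR_matrix_vector_assoc[symmetric])
qed

lemma metric_at_eq: "metric_at G y v w = v \<bullet> (G y *v w)"
  by (simp add: metric_at_def inner_vec_def matrix_vector_mult_def sum_distrib_left mult_ac)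

lemma matrix_mult_matrix_inv:
  fixes A :: "real^'n::finite^'n"
  assumes "det A \<noteq> 0"
  shows "A ** matrix_inv A = mat 1"
  using assms unfolding invertible_det_nz[symmetric] invertible_def matrix_inv_def
  by (rule someI2_ex) simp

text \<open>Cramer's rule exhibits the entries of the inverse as rational functions of the entries of
  the matrix, which makes the Christoffel symbols differentiable.\<close>
lemma matrix_inv_cofactor:
  fixes A :: "real^'n::finite^'n"
  assumes "det A \<noteq> 0"
  shows "matrix_inv A $ k $ j = det (\<chi> i l. if l = k then axis j 1 $ i else A $ i $ l) / det A"
proof -
  have "A *v (matrix_inv A *v axis j 1) = axis j 1"
    using assms by (simp add: matrix_vector_mul_assoc matrix_mult_matrix_inv)
  then have "(matrix_inv A *v axis j 1) $ k = det (\<chi> i l. if l = k then axis j 1 $ i else A $ i $ l) / det A"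
    using cramer[OF assms] by simp
  then show ?thesis by (simp add: matrix_vector_mult_basis column_def)
qed

lemma differentiable_det:
  fixes A :: "'a::real_normed_vector \<Rightarrow> real^'n::finite^'n"
  assumes "\<And>i j. (\<lambda>x. A x $ i $ j) differentiable at x"
  shows "(\<lambda>x. det (A x)) differentiable at x"
proof -
  have "(\<lambda>x. \<Prod>i\<in>UNIV. A x $ i $ p i) differentiable at x" for p
  proof -
    have "((\<lambda>x. \<Prod>i\<in>UNIV. A x $ i $ p i) has_derivative (\<lambda>y. \<Sum>i\<in>UNIV.
        frechet_derivative (\<lambda>x. A x $ i $ p i) (at x) y * (\<Prod>j\<in>UNIV - {i}. A x $ j $ p j))) (at x)"
      by (rule has_derivative_prod) (use assms in \<open>simp add: frechet_derivative_works\<close>)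
    then show ?thesis by (auto simp: differentiable_def)
  qed
  then show ?thesis unfolding det_def by (intro differentiable_sum) (auto intro!: differentiable_mult)
qed

text \<open>The Christoffel symbols with fixed upper index form a matrix, so that the connection term of a
  covariant derivative is a quadratic expression and obeys the product rule \<open>pd_quadratic\<close>.\<close>
definition chris_matrix :: "(real^'n::finite \<Rightarrow> real^'n^'n) \<Rightarrow> 'n \<Rightarrow> real^'n \<Rightarrow> real^'n^'n" where
  "chris_matrix G i y = (\<chi> j k. christoffel G i j k y)"

definition chris :: "(real^'n::finite \<Rightarrow> real^'n^'n) \<Rightarrow> real^'n \<Rightarrow> real^'n \<Rightarrow> real^'n \<Rightarrow> real^'n" where
  "chris G y v w = (\<chi> i. v \<bullet> (chris_matrix G i y *v w))"

lemma chris_nth: "chris G y v w $ i = (\<Sum>j\<in>UNIV. \<Sum>k\<in>UNIV. christoffel G i j k y * v $ j * w $ k)"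
  by (simp add: chris_def chris_matrix_def inner_vec_def matrix_vector_mult_def sum_distrib_left mult_ac)

lemma chris_add: "chris G y v (w + z) = chris G y v w + chris G y v z"
  by (simp add: chris_def vec_eq_iff matrix_vector_right_distrib inner_add_right)

locale riemannian_patch =
  fixes G :: "real^'m::finite \<Rightarrow> real^'m^'m" and V :: "(real^'m) set"
  assumes open_V: "open V"
    and smooth_G: "smooth_on V G"
    and G_sym: "y \<in> V \<Longrightarrow> transpose (G y) = G y"
    and G_pos: "y \<in> V \<Longrightarrow> v \<noteq> 0 \<Longrightarrow> 0 < metric_at G y v v"
begin

lemma det_G: assumes "y \<in> V" shows "det (G y) \<noteq> 0"
proof -
  have "v = 0" if "G y *v v = 0" for v
    using G_pos[OF assms, of v] that by (auto simp: metric_at_eq)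
  then show ?thesis
    by (metis invertible_det_nz matrix_left_invertible_ker invertible_left_inverse)
qed

lemma metric_sym: "y \<in> V \<Longrightarrow> metric_at G y v w = metric_at G y w v"
  unfolding metric_at_eq by (intro inner_matrix_sym G_sym)

lemma G_diff: "y \<in> V \<Longrightarrow> G differentiable at y" "y \<in> V \<Longrightarrow> pd i G differentiable at y"
  by (auto intro: smooth_on_differentiable smooth_on_pd smooth_G open_V)

lemma pd_G_nth:
  assumes "y \<in> V" shows "pd i (\<lambda>z. G z $ j $ k) y = pd i G y $ j $ k"
proof -
  have "(\<lambda>z. G z $ j) differentiable at y"
    using assms by (intro smooth_on_differentiable[of V] smooth_on_vec_nth open_V smooth_G)
  then show ?thesis using G_diff(1)[OF assms] by (simp add: pd_vec_nth)
qed

lemma pd_G_sym: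
  assumes "y \<in> V" shows "pd i G y $ j $ k = pd i G y $ k $ j"
proof -
  have "pd i (\<lambda>z. G z $ j $ k) y = pd i (\<lambda>z. G z $ k $ j) y"
  proof (rule pd_cong[OF open_V assms])
    show "G z $ j $ k = G z $ k $ j" if "z \<in> V" for z
      using arg_cong[OF G_sym[OF that], of "\<lambda>M. M $ j $ k"] by (simp add: transpose_def)
    show "(\<lambda>z. G z $ j $ k) differentiable at y"
      using assms by (intro smooth_on_differentiable[of V] smooth_on_vec_nth open_V smooth_G)
  qed
  then show ?thesis using assms by (simp add: pd_G_nth)
qed

abbreviation "dG y \<equiv> frechet_derivative G (at y)"

lemma dG_sym: assumes "y \<in> V" shows "transpose (dG y v) = dG y v"
  using pd_G_sym[OF assms] frechet_eq_sum_pd[OF G_diff(1)[OF assms], of v]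
  by (simp add: vec_eq_iff transpose_def)

lemma christoffel_sym:
  assumes "y \<in> V" shows "christoffel G i j k y = christoffel G i k j y"
  using pd_G_sym[OF assms] unfolding christoffel_def
  by (simp add: pd_G_nth[OF assms] add.commute)

lemma chris_sym: assumes "y \<in> V" shows "chris G y v w = chris G y w v"
proof -
  have "transpose (chris_matrix G i y) = chris_matrix G i y" for i
    using christoffel_sym[OF assms] by (simp add: chris_matrix_def transpose_def vec_eq_iff)
  then show ?thesis unfolding chris_def by (metis inner_matrix_sym)
qed

lemma chris_eq:
  assumes y: "y \<in> V"
  shows "chris G y v w = matrix_inv (G y) *v
    (\<chi> l. ((dG y v *v w) $ l + (dG y w *v v) $ l - v \<bullet> (pd l G y *v w)) / 2)"
proof -
  have dG_nth: "dG y v $ l $ k = (\<Sum>j\<in>UNIV. v $ j * pd j G y $ l $ k)" for v l k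
    by (simp add: frechet_eq_sum_pd[OF G_diff(1)[OF y], of v])
  have "chris G y v w $ i = (\<Sum>l\<in>UNIV. matrix_inv (G y) $ i $ l *
    (((dG y v *v w) $ l + (dG y w *v v) $ l - v \<bullet> (pd l G y *v w)) / 2))" for i
  proof -
    have "chris G y v w $ i = (\<Sum>j\<in>UNIV. \<Sum>k\<in>UNIV. \<Sum>l\<in>UNIV. matrix_inv (G y) $ i $ l *
        ((pd j G y $ l $ k + pd k G y $ l $ j - pd l G y $ j $ k) * v $ j * w $ k / 2))"
      by (simp add: chris_nth christoffel_def pd_G_nth[OF y] sum_distrib_left sum_distrib_right sum_divide_distrib mult_ac)
    also have "\<dots> = (\<Sum>l\<in>UNIV. matrix_inv (G y) $ i $ l *
        (\<Sum>j\<in>UNIV. \<Sum>k\<in>UNIV. (pd j G y $ l $ k + pd k G y $ l $ j - pd l G y $ j $ k) * v $ j * w $ k / 2))"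
      by (simp add: sum_distrib_left)
        (subst sum.swap, rule sum.cong, simp, subst sum.swap, rule refl)
    also have "\<dots> = (\<Sum>l\<in>UNIV. matrix_inv (G y) $ i $ l *
      (((dG y v *v w) $ l + (dG y w *v v) $ l - v \<bullet> (pd l G y *v w)) / 2))"
    proof (intro sum.cong refl arg_cong2[of _ _ _ _ "(*)"])
      fix l
      have 1: "(dG y v *v w) $ l = (\<Sum>j\<in>UNIV. \<Sum>k\<in>UNIV. pd j G y $ l $ k * v $ j * w $ k)" for v w
        by (simp add: matrix_vector_mult_def dG_nth sum_distrib_left mult_ac)
          (rule sum.swap)
      have 2: "(dG y w *v v) $ l = (\<Sum>j\<in>UNIV. \<Sum>k\<in>UNIV. pd k G y $ l $ j * v $ j * w $ k)"
        by (simp add: 1 mult_ac) (rule sum.swap)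
      have 3: "v \<bullet> (pd l G y *v w) = (\<Sum>j\<in>UNIV. \<Sum>k\<in>UNIV. pd l G y $ j $ k * v $ j * w $ k)"
        by (simp add: inner_vec_def matrix_vector_mult_def sum_distrib_left mult_ac)
      show "(\<Sum>j\<in>UNIV. \<Sum>k\<in>UNIV. (pd j G y $ l $ k + pd k G y $ l $ j - pd l G y $ j $ k) * v $ j * w $ k / 2)
        = ((dG y v *v w) $ l + (dG y w *v v) $ l - v \<bullet> (pd l G y *v w)) / 2"
        unfolding 2 unfolding 1 3
        by (simp add: sum.distrib[symmetric] sum_subtractf[symmetric] sum_divide_distrib algebra_simps)
    qed
    finally show ?thesis .
  qed
  then show ?thesis by (simp add: vec_eq_iff matrix_vector_mult_def)
qed

text \<open>Lowering the upper index removes the inverse metric; metric compatibility and Koszul's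
  formula only ever see this form.\<close>
lemma chris_lower:
  assumes y: "y \<in> V"
  shows "metric_at G y z (chris G y v w) =
    (z \<bullet> (dG y v *v w) + z \<bullet> (dG y w *v v) - v \<bullet> (dG y z *v w)) / 2"
proof -
  define b where "b = (\<chi> l. ((dG y v *v w) $ l + (dG y w *v v) $ l - v \<bullet> (pd l G y *v w)) / 2)"
  have "metric_at G y z (chris G y v w) = z \<bullet> b"
    using det_G[OF y]
    by (simp add: metric_at_eq chris_eq[OF y] b_def[symmetric] matrix_vector_mul_assoc matrix_mult_matrix_inv)
  also have "\<dots> = (z \<bullet> (dG y v *v w) + z \<bullet> (dG y w *v v) - (\<Sum>l\<in>UNIV. z $ l * (v \<bullet> (pd l G y *v w)))) / 2"
    by (simp add: b_def inner_vec_def[of z] sum.distrib[symmetric] sum_subtractf[symmetric] sum_divide_distrib algebra_simps)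
  also have "(\<Sum>l\<in>UNIV. z $ l * (v \<bullet> (pd l G y *v w))) = v \<bullet> (dG y z *v w)"
    by (simp add: frechet_eq_sum_pd[OF G_diff(1)[OF y]] inner_matrix_sum)
  finally show ?thesis .
qed

lemma christoffel_diff:
  assumes y: "y \<in> V"
  shows "chris_matrix G i differentiable at y"
proof -
  have Gn: "(\<lambda>z. G z $ j $ k) differentiable at y" for j k
    by (rule smooth_on_differentiable[OF _ open_V y]) (intro smooth_on_vec_nth open_V smooth_G)
  have pdn: "(\<lambda>z. pd l (\<lambda>z. G z $ j $ k) z) differentiable at y" for j k l
    by (rule smooth_on_differentiable[OF _ open_V y]) (intro smooth_on_pd smooth_on_vec_nth open_V smooth_G)
  have inv: "(\<lambda>z. matrix_inv (G z) $ j $ k) differentiable at y" for j k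
  proof -
    have num: "(\<lambda>z. det (\<chi> i l. if l = j then axis k 1 $ i else G z $ i $ l)) differentiable at y"
      by (rule differentiable_det, rename_tac a b, case_tac "b = j") (simp_all add: Gn)
    have "(\<lambda>z. det (\<chi> i l. if l = j then axis k 1 $ i else G z $ i $ l) / det (G z)) differentiable at y"
      using num differentiable_det[OF Gn] det_G[OF y] by (rule differentiable_divide)
    then obtain D where
      D: "((\<lambda>z. det (\<chi> i l. if l = j then axis k 1 $ i else G z $ i $ l) / det (G z)) has_derivative D) (at y)"
      by (auto simp: differentiable_def)
    have "((\<lambda>z. matrix_inv (G z) $ j $ k) has_derivative D) (at y)"
      by (rule has_derivative_transform_within_open[OF D open_V y]) (simp add: matrix_inv_cofactor det_G)
    then show ?thesis by (auto simp: differentiable_def)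
  qed
  have c: "(\<lambda>z. christoffel G i j k z) differentiable at y" for j k
    unfolding christoffel_def
    by (intro differentiable_divide differentiable_sum differentiable_mult inv differentiable_diff
        differentiable_add pdn differentiable_const ballI) auto
  have "chris_matrix G i = (\<lambda>z. \<Sum>j\<in>UNIV. \<Sum>k\<in>UNIV. christoffel G i j k z *\<^sub>R (\<chi> a b. if a = j \<and> b = k then 1 else 0))"
  proof -
    have "(if a = j \<and> b = k then (1::real) else 0) = (if j = a then if k = b then 1 else 0 else 0)" for a b j k :: 'm
      by auto
    then show ?thesis
      by (auto simp: chris_matrix_def vec_eq_iff fun_eq_iff if_distrib[of "\<lambda>x. _ * x"] sum.If_cases cong: if_cong)
  qed
  then show ?thesis
    by (simp only:) (intro differentiable_sum differentiable_scaleR c ballI differentiable_const; simp)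
qed

text \<open>For constant fields the Lie bracket and the derivatives of the components vanish, which leaves
  the classical expression in the Christoffel symbols and their first derivatives.\<close>
lemma curvature_eq:
  assumes y: "y \<in> V"
  shows "curvature G y v w z =
    (\<chi> i. w \<bullet> (frechet_derivative (chris_matrix G i) (at y) v *v z))
    - (\<chi> i. v \<bullet> (frechet_derivative (chris_matrix G i) (at y) w *v z))
    + chris G y v (chris G y w z) - chris G y w (chris G y v z)"
proof -
  have lb: "lie_bracket (\<lambda>_. v) (\<lambda>_. w) = (\<lambda>_. 0)" for v w :: "real^'m"
    by (simp add: lie_bracket_def fun_eq_iff vec_eq_iff)
  have n0: "nabla G (\<lambda>_. 0) Z = (\<lambda>_. 0)" for Z
    by (simp add: nabla_def fun_eq_iff vec_eq_iff)
  have n1: "nabla G (\<lambda>_. w) (\<lambda>_. z) = (\<lambda>y. chris G y w z)" for w z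
    by (simp add: nabla_def fun_eq_iff vec_eq_iff chris_nth)
  have n2: "nabla G (\<lambda>_. v) (\<lambda>y. chris G y w z) y =
    (\<chi> i. w \<bullet> (frechet_derivative (chris_matrix G i) (at y) v *v z)) + chris G y v (chris G y w z)" for v w
  proof -
    have "(\<Sum>j\<in>UNIV. v $ j * pd j (\<lambda>q. chris G q w z $ i) y)
      = w \<bullet> (frechet_derivative (chris_matrix G i) (at y) v *v z)" for i
    proof -
      have "pd j (\<lambda>q. chris G q w z $ i) y = w \<bullet> (pd j (chris_matrix G i) y *v z)" for j
        by (simp add: chris_def pd_quadratic[OF christoffel_diff[OF y]])
      then show ?thesis
        by (simp add: frechet_eq_sum_pd[OF christoffel_diff[OF y]] inner_matrix_sum)
    qed
    then show ?thesis by (simp add: nabla_def vec_eq_iff chris_nth)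
  qed
  show ?thesis unfolding curvature_def curvature_field_def lb n0 n1 n2 by simp
qed

end

section \<open>Covariant derivatives along an immersed surface and the Gauss equation\<close>

text \<open>The pointwise companion of \<open>smooth_on_vec_lambda\<close>, for the connection term, where only
  differentiability of the Christoffel symbols is at hand.\<close>
lemma differentiable_vec_lambda:
  fixes f :: "'m::finite \<Rightarrow> 'a::real_normed_vector \<Rightarrow> real"
  assumes "\<And>i. f i differentiable at u"
  shows "(\<lambda>u. \<chi> i. f i u) differentiable at u"
proof -
  have "(\<lambda>u. \<Sum>i\<in>UNIV. f i u *\<^sub>R axis i (1::real)) differentiable at u"
    using assms by (intro differentiable_sum differentiable_scaleR differentiable_const ballI) auto
  moreover have "(\<lambda>u. \<Sum>i\<in>UNIV. f i u *\<^sub>R axis i (1::real)) = (\<lambda>u. \<chi> i. f i u)"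
    using basis_expansion[of "\<chi> i. f i u" for u] by (simp add: fun_eq_iff scalar_mult_eq_scaleR)
  ultimately show ?thesis by simp
qed

locale immersed_patch = riemannian_patch G V
  for G :: "real^'m::finite \<Rightarrow> real^'m^'m" and V +
  fixes x :: "real^2 \<Rightarrow> real^'m" and W :: "(real^2) set"
  assumes open_W: "open W"
    and smooth_x: "smooth_on W x"
    and x_in_V: "u \<in> W \<Longrightarrow> x u \<in> V"
    and immersion: "u \<in> W \<Longrightarrow> inj (frechet_derivative x (at u))"
begin

abbreviation "ip u \<equiv> metric_at G (x u)"
abbreviation "e a \<equiv> pd a x"

text \<open>The pullback of the ambient connection, acting on vector fields along the surface. It agrees with
  \<open>nabla_along\<close> on differentiable fields but differentiates vectors instead of components.\<close>
definition covd :: "2 \<Rightarrow> (real^2 \<Rightarrow> real^'m) \<Rightarrow> real^2 \<Rightarrow> real^'m" where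
  "covd a Y u = pd a Y u + chris G (x u) (e a u) (Y u)"

lemma smooth_e: "smooth_on W (e a)"
  by (intro smooth_on_pd smooth_x)

lemma smooth_diff: "smooth_on W f \<Longrightarrow> u \<in> W \<Longrightarrow> f differentiable at u"
  by (rule smooth_on_differentiable[OF _ open_W])

lemma smooth_Gx: "smooth_on W (\<lambda>u. G (x u))"
  using x_in_V by (intro smooth_on_compose[OF open_W open_V _ smooth_x smooth_G]) auto

lemma smooth_ip: "smooth_on W Y \<Longrightarrow> smooth_on W Z \<Longrightarrow> smooth_on W (\<lambda>u. ip u (Y u) (Z u))"
  unfolding metric_at_eq by (intro smooth_on_quadratic open_W smooth_Gx)

lemma ip_differentiable:
  "u \<in> W \<Longrightarrow> Y differentiable at u \<Longrightarrow> Z differentiable at u \<Longrightarrow> (\<lambda>u. ip u (Y u) (Z u)) differentiable at u"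
  unfolding metric_at_eq by (intro differentiable_quadratic smooth_diff[OF smooth_Gx])

lemma ip_add: "ip u v (w + z) = ip u v w + ip u v z" "ip u (v + w) z = ip u v z + ip u w z"
  by (simp_all add: metric_at_eq matrix_vector_right_distrib inner_add_right inner_add_left)

lemma ip_diff: "ip u v (w - z) = ip u v w - ip u v z" "ip u (v - w) z = ip u v z - ip u w z"
  by (simp_all add: metric_at_eq matrix_vector_mult_diff_distrib inner_diff_right inner_diff_left)

lemma ip_scaleR: "ip u v (r *\<^sub>R w) = r * ip u v w" "ip u (r *\<^sub>R v) w = r * ip u v w"
  by (simp_all add: metric_at_eq matrix_vector_mult_scaleR)

lemma ip_sum: "ip u v (\<Sum>i\<in>I. f i) = (\<Sum>i\<in>I. ip u v (f i))" "ip u (\<Sum>i\<in>I. f i) v = (\<Sum>i\<in>I. ip u (f i) v)"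
  by (induction I rule: infinite_finite_induct, auto simp: ip_add, auto simp: metric_at_eq)

lemma ip_sym: "u \<in> W \<Longrightarrow> ip u v w = ip u w v"
  by (rule metric_sym[OF x_in_V])

lemma metric_compat:
  assumes u: "u \<in> W" and Y: "Y differentiable at u" and Z: "Z differentiable at u"
  shows "pd a (\<lambda>u. ip u (Y u) (Z u)) u = ip u (covd a Y u) (Z u) + ip u (Y u) (covd a Z u)"
proof -
  note y = x_in_V[OF u]
  have dx: "x differentiable at u" by (rule smooth_diff[OF smooth_x u])
  have M: "pd a (\<lambda>u. G (x u)) u = dG (x u) (e a u)"
    by (rule pd_compose[OF dx G_diff(1)[OF y]])
  have s: "v \<bullet> (dG (x u) q *v w) = w \<bullet> (dG (x u) q *v v)" for q v w
    by (rule inner_matrix_sym[OF dG_sym[OF y]])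
  have "ip u (chris G (x u) (e a u) (Y u)) (Z u) + ip u (Y u) (chris G (x u) (e a u) (Z u))
    = Y u \<bullet> (dG (x u) (e a u) *v Z u)"
    unfolding ip_sym[OF u, of "chris G (x u) (e a u) (Y u)"] chris_lower[OF y]
    using s[of "Z u" "e a u" "Y u"] s[of "Z u" "Y u" "e a u"] s[of "Y u" "Z u" "e a u"]
    by (simp add: field_simps)
  then show ?thesis
    using pd_quadratic[OF smooth_diff[OF smooth_Gx u] Y Z, of a]
    by (simp add: covd_def ip_add M metric_at_eq matrix_vector_right_distrib inner_add_left inner_add_right)
qed

lemma torsion_free: "u \<in> W \<Longrightarrow> covd a (e b) u = covd b (e a) u"
  unfolding covd_def using pd_commute[OF open_W _ smooth_x] chris_sym[OF x_in_V] by metis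

lemma chris_nth_diff:
  assumes u: "u \<in> W" and "Y differentiable at u" "Z differentiable at u"
  shows "(\<lambda>u. chris G (x u) (Y u) (Z u) $ i) differentiable at u"
  unfolding chris_def
  using differentiable_quadratic[OF differentiable_compose[OF christoffel_diff[OF x_in_V[OF u]] smooth_diff[OF smooth_x u]] assms(2,3)]
  by simp

lemma chris_diff:
  assumes u: "u \<in> W" and "Y differentiable at u" "Z differentiable at u"
  shows "(\<lambda>u. chris G (x u) (Y u) (Z u)) differentiable at u"
  using differentiable_vec_lambda[where f="\<lambda>i u. chris G (x u) (Y u) (Z u) $ i", OF chris_nth_diff[OF assms]]
  by simp

lemma covd_diff:
  assumes "u \<in> W" "smooth_on W Y"
  shows "covd a Y differentiable at u"
  unfolding covd_def[abs_def]
  by (intro differentiable_add chris_diff smooth_diff[OF _ assms(1)] smooth_on_pd assms smooth_x)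

lemma pd_chris:
  assumes u: "u \<in> W" and Y: "Y differentiable at u" and Z: "Z differentiable at u"
  shows "pd a (\<lambda>u. chris G (x u) (Y u) (Z u)) u = chris G (x u) (pd a Y u) (Z u) + chris G (x u) (Y u) (pd a Z u)
    + (\<chi> i. Y u \<bullet> (frechet_derivative (chris_matrix G i) (at (x u)) (e a u) *v Z u))"
proof -
  have dx: "x differentiable at u" by (rule smooth_diff[OF smooth_x u])
  note c = christoffel_diff[OF x_in_V[OF u]]
  have "pd a (\<lambda>u. chris G (x u) (Y u) (Z u)) u $ i = pd a (\<lambda>u. chris G (x u) (Y u) (Z u) $ i) u" for i
    by (rule pd_vec_nth[symmetric]) (rule chris_diff[OF assms])
  moreover have "pd a (\<lambda>u. chris G (x u) (Y u) (Z u) $ i) u = pd a Y u \<bullet> (chris_matrix G i (x u) *v Z u)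
    + Y u \<bullet> (chris_matrix G i (x u) *v pd a Z u)
    + Y u \<bullet> (frechet_derivative (chris_matrix G i) (at (x u)) (e a u) *v Z u)" for i
    unfolding chris_def
    by (simp add: pd_quadratic[OF differentiable_compose[OF c dx] Y Z] pd_compose[OF dx c])
  ultimately show ?thesis by (simp add: vec_eq_iff) (simp add: chris_def)
qed

text \<open>By the chain rule the derivative of the Christoffel symbols along the surface is their derivative in
  the direction \<open>e\<^sub>a\<close>; every other term is symmetric in \<open>a\<close> and \<open>b\<close> or belongs to the quadratic part of
  the curvature.\<close>
lemma covd_commutator:
  assumes u: "u \<in> W" and Y: "smooth_on W Y"
  shows "covd a (covd b Y) u - covd b (covd a Y) u = curvature G (x u) (e a u) (e b u) (Y u)"
proof -
  have *: "covd a (covd b Y) u = pd a (pd b Y) u + chris G (x u) (pd a (e b) u) (Y u)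
    + chris G (x u) (e b u) (pd a Y u) + chris G (x u) (e a u) (pd b Y u)
    + (\<chi> i. e b u \<bullet> (frechet_derivative (chris_matrix G i) (at (x u)) (e a u) *v Y u))
    + chris G (x u) (e a u) (chris G (x u) (e b u) (Y u))" for a b
  proof -
    have d: "pd b Y differentiable at u" "e b differentiable at u" "Y differentiable at u"
      using Y u smooth_on_pd smooth_e by (auto intro: smooth_diff)
    have "pd a (covd b Y) u = pd a (pd b Y) u + pd a (\<lambda>u. chris G (x u) (e b u) (Y u)) u"
      unfolding covd_def[abs_def] using chris_diff[OF u d(2,3)] d by (simp add: pd_add)
    then show ?thesis
      using pd_chris[OF u d(2,3), of a]
      by (simp add: covd_def chris_add)
  qed
  show ?thesis
    unfolding * curvature_eq[OF x_in_V[OF u]]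
    using pd_commute[OF open_W u Y, of a b] pd_commute[OF open_W u smooth_x, of a b] by simp
qed

text \<open>Second derivatives of \<open>\<langle>Y,Z\<rangle>\<close> commute, so the curvature, being the commutator of two metric
  derivations, is skew.\<close>
lemma curvature_antisym:
  assumes u: "u \<in> W" and Y: "smooth_on W Y" and Z: "smooth_on W Z"
  shows "ip u (curvature G (x u) (e a u) (e b u) (Y u)) (Z u)
    = - ip u (Y u) (curvature G (x u) (e a u) (e b u) (Z u))"
proof -
  define q where "q = (\<lambda>u. ip u (Y u) (Z u))"
  have q: "smooth_on W q" unfolding q_def by (rule smooth_ip[OF Y Z])
  have "pd a (pd b q) u = ip u (covd a (covd b Y) u) (Z u) + ip u (covd b Y u) (covd a Z u)
    + ip u (covd a Y u) (covd b Z u) + ip u (Y u) (covd a (covd b Z) u)" for a b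
  proof -
    have D: "Y differentiable at v" "Z differentiable at v" "covd b Y differentiable at v" "covd b Z differentiable at v"
      if "v \<in> W" for v
      using Y Z that covd_diff by (auto intro: smooth_diff)
    have "pd a (pd b q) u = pd a (\<lambda>u. ip u (covd b Y u) (Z u) + ip u (Y u) (covd b Z u)) u"
    proof (rule pd_cong[OF open_W u])
      show "pd b q v = ip v (covd b Y v) (Z v) + ip v (Y v) (covd b Z v)" if "v \<in> W" for v
        unfolding q_def by (rule metric_compat) (use D that in auto)
      show "pd b q differentiable at u" by (intro smooth_diff smooth_on_pd q u)
    qed
    also have "\<dots> = pd a (\<lambda>u. ip u (covd b Y u) (Z u)) u + pd a (\<lambda>u. ip u (Y u) (covd b Z u)) u"
      using D[OF u] u by (intro pd_add ip_differentiable)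
    finally show ?thesis using D[OF u] u by (simp add: metric_compat)
  qed
  with pd_commute_real[OF open_W u q, of a b] show ?thesis
    unfolding covd_commutator[OF u Y, symmetric] covd_commutator[OF u Z, symmetric] by (simp add: ip_diff)
qed

abbreviation "h \<equiv> induced_metric G x"

lemma h_nth: "h u $ a $ b = ip u (e a u) (e b u)"
  by (simp add: induced_metric_def)

definition christoffel_first :: "2 \<Rightarrow> 2 \<Rightarrow> 2 \<Rightarrow> real^2 \<Rightarrow> real" where
  "christoffel_first a b c u =
    (pd a (\<lambda>v. h v $ b $ c) u + pd b (\<lambda>v. h v $ a $ c) u - pd c (\<lambda>v. h v $ a $ b) u) / 2"

text \<open>The tangential part of \<open>D\<^sub>ae\<^sub>b\<close> depends on the induced metric only. This is the link between the
  ambient and the intrinsic geometry.\<close>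
lemma koszul:
  assumes u: "u \<in> W"
  shows "ip u (covd a (e b) u) (e c u) = christoffel_first a b c u"
proof -
  have "pd c (\<lambda>v. h v $ a $ b) u = ip u (covd c (e a) u) (e b u) + ip u (covd c (e b) u) (e a u)" for a b c
    unfolding h_nth using metric_compat[OF u smooth_diff[OF smooth_e u] smooth_diff[OF smooth_e u]]
    by (simp add: ip_sym[OF u, of "e a u"])
  then show ?thesis
    unfolding christoffel_first_def
    using torsion_free[OF u, of a b] torsion_free[OF u, of a c] torsion_free[OF u, of b c] by simp
qed

text \<open>Metric compatibility moves the outer derivative of \<open>D\<^sub>1D\<^sub>2e\<^sub>2\<close> and \<open>D\<^sub>2D\<^sub>1e\<^sub>2\<close> onto the inner products with
  \<open>e\<^sub>1\<close>, which are Christoffel symbols of the first kind by Koszul's formula.\<close>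
lemma curvature_component:
  assumes u: "u \<in> W"
  shows "ip u (curvature G (x u) (e 1 u) (e 2 u) (e 2 u)) (e 1 u) =
    pd 1 (christoffel_first 2 2 1) u - pd 2 (christoffel_first 1 2 1) u
    - ip u (covd 1 (e 1) u) (covd 2 (e 2) u) + ip u (covd 1 (e 2) u) (covd 1 (e 2) u)"
proof -
  have "pd c (christoffel_first a 2 1) u =
    ip u (covd c (covd a (e 2)) u) (e 1 u) + ip u (covd a (e 2) u) (covd c (e 1) u)" for a c
  proof -
    have d: "covd a (e 2) differentiable at u" "e 1 differentiable at u"
      by (auto intro: covd_diff smooth_diff smooth_e u)
    \<comment> \<open>both functions agree on the open set \<open>W\<close>, not only at \<open>u\<close>\<close>
    have "pd c (christoffel_first a 2 1) u = pd c (\<lambda>u. ip u (covd a (e 2) u) (e 1 u)) u"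
      by (rule pd_cong[OF open_W u, symmetric]) (auto simp: koszul intro: ip_differentiable u d)
    with metric_compat[OF u d] show ?thesis by simp
  qed
  then show ?thesis
    unfolding covd_commutator[OF u smooth_e, symmetric]
    using torsion_free[OF u, of 1 2]
    by (simp add: ip_diff ip_sym[OF u, of "covd 1 (e 1) u" "covd 2 (e 2) u"])
qed

lemma frechet_x:
  assumes "u \<in> W" shows "frechet_derivative x (at u) v = v $ 1 *\<^sub>R e 1 u + v $ 2 *\<^sub>R e 2 u"
  using smooth_diff[OF smooth_x assms] by (simp add: frechet_eq_sum_pd sum_2)

lemma metric_h:
  assumes u: "u \<in> W"
  shows "metric_at h u v w = ip u (frechet_derivative x (at u) v) (frechet_derivative x (at u) w)"
  by (simp add: frechet_x[OF u] metric_at_def[of h] sum_2 h_nth ip_add ip_scaleR algebra_simps)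

lemma e_independent:
  assumes "u \<in> W" "r *\<^sub>R e 1 u + s *\<^sub>R e 2 u = 0" shows "r = 0 \<and> s = 0"
proof -
  have "frechet_derivative x (at u) (vector [r, s]) = frechet_derivative x (at u) 0"
    using assms by (simp add: frechet_x vector_2)
  then have "vector [r, s] = (0::real^2)" using immersion[OF assms(1)] by (simp add: inj_eq)
  then show ?thesis by (metis vector_2 zero_index)
qed

lemma h_riemannian: "riemannian_patch h W"
proof
  show "open W" by (rule open_W)
  show "smooth_on W h"
    unfolding induced_metric_def[abs_def]
    by (intro smooth_on_vec_lambda open_W smooth_ip smooth_e)
  show "transpose (h u) = h u" if "u \<in> W" for u
    using ip_sym[OF that] by (simp add: vec_eq_iff transpose_def induced_metric_def)
  show "0 < metric_at h u v v" if "u \<in> W" "v \<noteq> 0" for u v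
  proof -
    have "frechet_derivative x (at u) v \<noteq> frechet_derivative x (at u) 0"
      using immersion[OF that(1)] that(2) by (simp add: inj_eq)
    then show ?thesis
      unfolding metric_h[OF that(1)] using that by (intro G_pos x_in_V) (simp_all add: frechet_x)
  qed
qed

lemma h_sym: "u \<in> W \<Longrightarrow> h u $ 2 $ 1 = h u $ 1 $ 2"
  unfolding h_nth by (rule ip_sym)

lemma det_h: "u \<in> W \<Longrightarrow> det (h u) = h u $ 1 $ 1 * h u $ 2 $ 2 - (h u $ 1 $ 2)\<^sup>2"
  by (simp add: det_2 h_sym power2_eq_square)

lemma det_h_pos: assumes u: "u \<in> W" shows "det (h u) > 0"
proof -
  interpret H: riemannian_patch h W by (rule h_riemannian)
  have "metric_at h u (axis 1 1) (axis 1 1) > 0"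
    by (rule H.G_pos[OF u]) (simp add: axis_eq_0_iff)
  then have 1: "h u $ 1 $ 1 > 0" by (simp add: metric_at_def sum_2 axis_def)
  have "metric_at h u (vector [- h u $ 1 $ 2, h u $ 1 $ 1]) (vector [- h u $ 1 $ 2, h u $ 1 $ 1]) > 0"
    using 1 by (intro H.G_pos[OF u]) (metis vector_2(2) zero_index less_irrefl)
  moreover have "metric_at h u (vector [- h u $ 1 $ 2, h u $ 1 $ 1]) (vector [- h u $ 1 $ 2, h u $ 1 $ 1])
    = h u $ 1 $ 1 * det (h u)"
    by (simp add: metric_at_def sum_2 vector_2 det_h[OF u] h_sym[OF u] algebra_simps power2_eq_square)
  ultimately show ?thesis using 1 by (simp add: zero_less_mult_iff)
qed

text \<open>The inner product of the components of \<open>v\<close> and \<open>w\<close> orthogonal to the surface: the subtracted term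
  is the inner product of the tangential projections, with the inverse of the induced metric
  written out.\<close>
definition normal_part :: "real^2 \<Rightarrow> real^'m \<Rightarrow> real^'m \<Rightarrow> real" where
  "normal_part u v w = ip u v w -
    (h u $ 2 $ 2 * ip u v (e 1 u) * ip u w (e 1 u)
     - h u $ 1 $ 2 * (ip u v (e 1 u) * ip u w (e 2 u) + ip u v (e 2 u) * ip u w (e 1 u))
     + h u $ 1 $ 1 * ip u v (e 2 u) * ip u w (e 2 u)) / det (h u)"

end

text \<open>A metric on the parameter domain is an ambient metric for the identity map, so everything proved
  for immersions applies to the intrinsic geometry of the surface.\<close>
lemma identity_immersed_patch:
  assumes "riemannian_patch (h :: real^2 \<Rightarrow> real^2^2) W"
  shows "immersed_patch h W (\<lambda>u. u) W"
proof -
  interpret riemannian_patch h W by fact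
  have "frechet_derivative (\<lambda>u::real^2. u) (at u) = (\<lambda>v. v)" for u
    by (rule frechet_derivative_at[OF has_derivative_ident, symmetric])
  then show ?thesis
    by unfold_locales (auto simp: open_V smooth_on_id inj_def)
qed

lemma induced_metric_id: "induced_metric h (\<lambda>u. u) = h"
  by (simp add: fun_eq_iff vec_eq_iff induced_metric_def pd_id metric_at_def axis_def
      if_distrib[of "\<lambda>x. _ * x"] if_distrib[of "\<lambda>x. x * _"] sum.If_cases cong: if_cong)

text \<open>In dimension two the skew curvature operator has a single independent component.\<close>
lemma gaussian_curvature_2d:
  fixes h :: "real^2 \<Rightarrow> real^2^2"
  assumes "riemannian_patch h W" and u: "u \<in> W"
  shows "gaussian_curvature h u * det (h u) =
    metric_at h u (curvature h u (axis 1 1) (axis 2 1) (axis 2 1)) (axis 1 1)"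
proof -
  interpret H: immersed_patch h W "\<lambda>u. u" W by (rule identity_immersed_patch[OF assms(1)])
  define R where "R = (\<lambda>j::2. curvature h u (axis 1 1) (axis 2 1) (axis j 1))"
  have sw: "curvature h u (axis 2 1) (axis 1 1) z = - curvature h u (axis 1 1) (axis 2 1) z" for z
    by (simp add: H.curvature_eq[OF u])
  have same: "curvature h u v v z = 0" for v z
    by (simp add: H.curvature_eq[OF u])
  have anti: "metric_at h u (R i) (axis j 1) = - metric_at h u (axis i 1) (R j)" for i j
    using H.curvature_antisym[OF u smooth_on_const smooth_on_const, of 1 2 "axis i 1" "axis j 1"]
    by (simp add: pd_id R_def)
  have hs: "h u $ 2 $ 1 = h u $ 1 $ 2" using H.h_sym[OF u] by (simp add: induced_metric_id)
  have m: "metric_at h u v (axis j 1) = h u $ 1 $ j * v $ 1 + h u $ 2 $ j * v $ 2"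
     "metric_at h u (axis j 1) v = h u $ j $ 1 * v $ 1 + h u $ j $ 2 * v $ 2" for v j
    using exhaust_2[of j] by (auto simp: metric_at_def sum_2 axis_def)
  have d: "det (h u) \<noteq> 0" by (rule H.det_G[OF u])
  have inv: "matrix_inv (h u) $ 1 $ 1 = h u $ 2 $ 2 / det (h u)"
    "matrix_inv (h u) $ 1 $ 2 = - h u $ 1 $ 2 / det (h u)"
    "matrix_inv (h u) $ 2 $ 1 = - h u $ 1 $ 2 / det (h u)"
    "matrix_inv (h u) $ 2 $ 2 = h u $ 1 $ 1 / det (h u)"
    by (simp_all add: matrix_inv_cofactor[OF d] det_2 axis_def hs)
  have "scalar_curvature h u * det (h u) =
    - h u $ 2 $ 2 * R 1 $ 2 + h u $ 1 $ 2 * R 2 $ 2 - h u $ 1 $ 2 * R 1 $ 1 + h u $ 1 $ 1 * R 2 $ 1"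
    using d by (simp add: scalar_curvature_def sum_2 ricci_def sw same inv R_def field_simps)
  also have "\<dots> = 2 * metric_at h u (R 2) (axis 1 1)"
    using anti[of 1 1] anti[of 2 2] anti[of 1 2] by (simp add: m hs)
  finally show ?thesis by (simp add: gaussian_curvature_def R_def)
qed

context immersed_patch
begin

text \<open>The difference of two instances of \<open>curvature_component\<close>, for \<open>x\<close> and for the identity map of \<open>W\<close>.\<close>
lemma gauss_equation:
  assumes u: "u \<in> W"
  shows "gaussian_curvature h u * det (h u) =
    ip u (curvature G (x u) (e 1 u) (e 2 u) (e 2 u)) (e 1 u)
    + normal_part u (covd 1 (e 1) u) (covd 2 (e 2) u)
    - normal_part u (covd 1 (e 2) u) (covd 1 (e 2) u)"
proof -
  interpret H: immersed_patch h W "\<lambda>u. u" W by (rule identity_immersed_patch[OF h_riemannian])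
  have cf: "H.christoffel_first = christoffel_first"
    unfolding H.christoffel_first_def[abs_def] christoffel_first_def[abs_def] induced_metric_id ..
  define t where "t a b = H.covd a (pd b (\<lambda>u. u)) u" for a b
  have low: "metric_at h u (t a b) (axis c 1) = ip u (covd a (e b) u) (e c u)" for a b c
    using H.koszul[OF u, of a b c] koszul[OF u, of a b c] by (simp add: t_def cf pd_id)
  \<comment> \<open>a vector of the plane is determined by its inner products with \<open>e\<^sub>1\<close> and \<open>e\<^sub>2\<close>: Cramer's rule\<close>
  have two: "metric_at h u v w * det (h u) =
    h u $ 2 $ 2 * metric_at h u v (axis 1 1) * metric_at h u w (axis 1 1)
     - h u $ 1 $ 2 * (metric_at h u v (axis 1 1) * metric_at h u w (axis 2 1)
        + metric_at h u v (axis 2 1) * metric_at h u w (axis 1 1))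
     + h u $ 1 $ 1 * metric_at h u v (axis 2 1) * metric_at h u w (axis 2 1)" for v w :: "real^2"
    by (simp add: metric_at_def sum_2 axis_def det_2 h_sym[OF u] algebra_simps)
  have np: "normal_part u (covd a (e b) u) (covd c (e d) u) =
    ip u (covd a (e b) u) (covd c (e d) u) - metric_at h u (t a b) (t c d)" for a b c d
    using two[of "t a b" "t c d"] det_h_pos[OF u] unfolding normal_part_def low
    by (simp add: divide_eq_eq)
  have "gaussian_curvature h u * det (h u) =
    pd 1 (christoffel_first 2 2 1) u - pd 2 (christoffel_first 1 2 1) u
    - metric_at h u (t 1 1) (t 2 2) + metric_at h u (t 1 2) (t 1 2)"
    using gaussian_curvature_2d[OF h_riemannian u] H.curvature_component[OF u]
    by (simp add: cf pd_id t_def)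
  with curvature_component[OF u] show ?thesis unfolding np by simp
qed

end

section \<open>The Levi-Civita symbol and its contraction\<close>

text \<open>The position at which \<open>levi_civita\<close> reads the list for the index \<open>i\<close>.\<close>
abbreviation ordinal :: "'m::{finite,linorder} \<Rightarrow> nat" where
  "ordinal i \<equiv> card {y. y < i}"

lemma ordinal_bij: "bij_betw ordinal (UNIV :: 'm::{finite,linorder} set) {..<CARD('m)}"
proof -
  have less: "ordinal i < ordinal j" if "i < j" for i j :: 'm
    using that by (intro psubset_card_mono) auto
  have "inj (ordinal :: 'm \<Rightarrow> nat)"
    by (rule linorder_injI) (use less in force)
  moreover have "ordinal i < CARD('m)" for i :: 'm
    by (rule psubset_card_mono) auto
  ultimately have "range (ordinal :: 'm \<Rightarrow> nat) = {..<CARD('m)}"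
    by (intro card_subset_eq) (auto simp: card_image)
  with \<open>inj ordinal\<close> show ?thesis
    unfolding bij_betw_def by blast
qed

lemma ordinal_surj: assumes "p < CARD('m)" obtains i :: "'m::{finite,linorder}" where "ordinal i = p"
proof -
  have "p \<in> range (ordinal :: 'm \<Rightarrow> nat)"
    using ordinal_bij[where 'm='m] assms by (simp add: bij_betw_def)
  then show thesis using that by blast
qed

lemma ordinal_eq_iff: "ordinal i = ordinal j \<longleftrightarrow> i = (j :: 'm::{finite,linorder})"
  using ordinal_bij[where 'm='m] unfolding bij_betw_def inj_on_def by blast

lemma ordinal_less: "ordinal (i :: 'm::{finite,linorder}) < CARD('m)"
  using ordinal_bij[where 'm='m] unfolding bij_betw_def by blast

lemma permutes_UNIV_iff_distinct:
  fixes xs :: "'m::{finite,linorder} list"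
  assumes "length xs = CARD('m)"
  shows "(\<lambda>i. xs ! ordinal i) permutes UNIV \<longleftrightarrow> distinct xs"
proof
  assume "(\<lambda>i. xs ! ordinal i) permutes UNIV"
  then have inj: "inj (\<lambda>i::'m. xs ! ordinal i)" by (rule permutes_inj)
  show "distinct xs"
    unfolding distinct_conv_nth
  proof (intro allI impI)
    fix p q assume "p < length xs" "q < length xs" "p \<noteq> q"
    moreover obtain i j :: 'm where "ordinal i = p" "ordinal j = q"
      using ordinal_surj calculation assms by metis
    ultimately show "xs ! p \<noteq> xs ! q" using inj unfolding inj_def by blast
  qed
next
  assume "distinct xs"
  then have "inj (\<lambda>i::'m. xs ! ordinal i)"
    using assms ordinal_less[where 'm='m] by (auto simp: inj_def nth_eq_iff_index_eq ordinal_eq_iff)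
  then show "(\<lambda>i. xs ! ordinal i) permutes UNIV"
    by (intro bij_imp_permutes) (auto simp: bij_def finite_UNIV_inj_surj)
qed

lemma levi_civita_not_distinct:
  fixes xs :: "'m::{finite,linorder} list"
  assumes "length xs = CARD('m)" "\<not> distinct xs"
  shows "levi_civita xs = 0"
  using assms by (simp add: levi_civita_def permutes_UNIV_iff_distinct)

lemma levi_civita_square:
  fixes xs :: "'m::{finite,linorder} list"
  assumes "length xs = CARD('m)" "distinct xs"
  shows "levi_civita xs * levi_civita xs = 1"
  using assms by (simp add: levi_civita_def permutes_UNIV_iff_distinct sign_def)

text \<open>Exchanging two entries composes the permutation with a transposition of the two indices that read
  these entries.\<close>
lemma levi_civita_swap:
  fixes xs :: "'m::{finite,linorder} list"
  assumes len: "length xs = CARD('m)" and pq: "p < length xs" "q < length xs" "p \<noteq> q"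
  shows "levi_civita (xs[p := xs ! q, q := xs ! p]) = - levi_civita xs"
proof (cases "distinct xs")
  case False
  then show ?thesis using assms by (simp add: levi_civita_not_distinct)
next
  case True
  obtain i j :: 'm where ij: "ordinal i = p" "ordinal j = q"
    using ordinal_surj pq len by metis
  have eq: "(\<lambda>k. xs[p := xs ! q, q := xs ! p] ! ordinal k) = (\<lambda>k. xs ! ordinal k) \<circ> Transposition.transpose i j"
  proof
    fix k :: 'm
    have "ordinal k < length xs" using ordinal_less[of k] len by simp
    then show "xs[p := xs ! q, q := xs ! p] ! ordinal k = ((\<lambda>k. xs ! ordinal k) \<circ> Transposition.transpose i j) k"
      using ij pq ordinal_eq_iff[of k i] ordinal_eq_iff[of k j]
      by (auto simp: transpose_def nth_list_update)
  qed
  have "permutation (\<lambda>k. xs ! ordinal k)"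
    using permutes_UNIV_iff_distinct[OF len] True unfolding permutation_permutes by (metis finite)
  then have "sign ((\<lambda>k. xs ! ordinal k) \<circ> Transposition.transpose i j) = - sign (\<lambda>k. xs ! ordinal k)"
    using ij pq by (subst sign_compose) (auto simp: permutation_swap_id sign_swap_id)
  moreover have "distinct (xs[p := xs ! q, q := xs ! p])"
    using True pq by simp
  ultimately show ?thesis
    using permutes_UNIV_iff_distinct[OF len] permutes_UNIV_iff_distinct[of "xs[p := xs ! q, q := xs ! p]"] len True
    unfolding levi_civita_def Let_def by (simp add: eq)
qed

lemma levi_civita_swap3:
  fixes I :: "'m::{finite,linorder} list"
  assumes "length I + 3 = CARD('m)"
  shows "levi_civita (k # j # l # I) = - levi_civita (j # k # l # I)"
    "levi_civita (j # l # k # I) = - levi_civita (j # k # l # I)"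
    "levi_civita (l # k # j # I) = - levi_civita (j # k # l # I)"
  using levi_civita_swap[of "j # k # l # I" 0 1] levi_civita_swap[of "j # k # l # I" 1 2]
    levi_civita_swap[of "j # k # l # I" 0 2] assms by (simp_all add: numeral_2_eq_2)

definition kron :: "'m \<Rightarrow> 'm \<Rightarrow> real" where
  "kron i j = (if i = j then 1 else 0)"

text \<open>The generalized Kronecker delta: the determinant of the \<open>3 \<times> 3\<close> matrix of Kronecker deltas.\<close>
definition kron3 :: "'m \<Rightarrow> 'm \<Rightarrow> 'm \<Rightarrow> 'm \<Rightarrow> 'm \<Rightarrow> 'm \<Rightarrow> real" where
  "kron3 j k l i m n =
    kron j i * (kron k m * kron l n - kron k n * kron l m)
    - kron j m * (kron k i * kron l n - kron k n * kron l i)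
    + kron j n * (kron k i * kron l m - kron k m * kron l i)"

text \<open>The nonzero terms belong to the enumerations of the \<open>r\<close> indices other than \<open>j\<close>, \<open>k\<close>, \<open>l\<close>.\<close>
lemma sum_levi_civita_square:
  fixes j k l :: "'m::{finite,linorder}"
  assumes r: "r + 3 = CARD('m)" and d: "distinct [j, k, l]"
  shows "(\<Sum>I\<in>{I. length I = r}. levi_civita (j # k # l # I) * levi_civita (j # k # l # I)) = fact r"
proof -
  have "levi_civita (j # k # l # I) * levi_civita (j # k # l # I) = (if distinct (j # k # l # I) then 1 else 0)"
    if "length I = r" for I
    using levi_civita_square[of "j # k # l # I"] levi_civita_not_distinct[of "j # k # l # I"] that r by auto
  then have "(\<Sum>I\<in>{I. length I = r}. levi_civita (j # k # l # I) * levi_civita (j # k # l # I))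
    = (\<Sum>I\<in>{I. length I = r}. if distinct (j # k # l # I) then 1 else 0)"
    by (intro sum.cong) auto
  also have "\<dots> = real (card {I. length I = r \<and> distinct (j # k # l # I)})"
    using finite_lists_length_eq[of "UNIV :: 'm set" r] by (subst sum.If_cases) (auto simp: Int_def)
  also have "{I. length I = r \<and> distinct (j # k # l # I)} = {I. length I = r \<and> distinct I \<and> set I \<subseteq> - {j, k, l}}"
    using d by auto
  also have "card (- {j, k, l}) = r"
    using d r by (simp add: Compl_eq_Diff_UNIV card_Diff_subset)
  then have "card {I. length I = r \<and> distinct I \<and> set I \<subseteq> - {j, k, l}} = fact r"
    by (subst card_lists_distinct_length_eq) (auto simp: fact_prod)
  finally show ?thesis by simp
qed

lemma levi_civita_same_complement:
  fixes j k l i m n :: "'m::{finite,linorder}"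
  assumes "length I + 3 = CARD('m)" "levi_civita (j # k # l # I) \<noteq> 0" "levi_civita (i # m # n # I) \<noteq> 0"
  shows "distinct [j, k, l] \<and> distinct [i, m, n] \<and> {j, k, l} = {i, m, n}"
proof -
  have d: "distinct (j # k # l # I)" "distinct (i # m # n # I)"
    using assms levi_civita_not_distinct[of "j # k # l # I"] levi_civita_not_distinct[of "i # m # n # I"] by auto
  have full: "set xs = UNIV" if "distinct xs" "length xs = CARD('m)" for xs :: "'m list"
    using that by (metis card_eq_UNIV_imp_eq_UNIV distinct_card finite)
  have "{j, k, l} = - set I" "{i, m, n} = - set I"
    using full[OF d(1)] full[OF d(2)] d assms(1) by auto
  with d show ?thesis by auto
qed

text \<open>Both sides vanish unless \<open>i\<close>, \<open>m\<close>, \<open>n\<close> is a permutation of the distinct \<open>j\<close>, \<open>k\<close>, \<open>l\<close>; in the six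
  remaining cases both are the sign of that permutation times the sum of squares.\<close>
lemma levi_civita_contraction:
  fixes j k l i m n :: "'m::{finite,linorder}"
  assumes r: "r + 3 = CARD('m)"
  shows "(\<Sum>I\<in>{I. length I = r}. levi_civita (j # k # l # I) * levi_civita (i # m # n # I))
    = fact r * kron3 j k l i m n"
proof (cases "distinct [j, k, l] \<and> distinct [i, m, n] \<and> {j, k, l} = {i, m, n}")
  case False
  then have "levi_civita (j # k # l # I) * levi_civita (i # m # n # I) = 0" if "length I = r" for I
    using levi_civita_same_complement[of I j k l i m n] that r by auto
  moreover have "kron3 j k l i m n = 0"
    using False unfolding kron3_def kron_def by (auto split: if_splits)
  ultimately show ?thesis by (auto intro!: sum.neutral)
next
  case True
  note sq = sum_levi_civita_square[OF r, of j k l]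
  have sw: "levi_civita (k # j # l # I) = - levi_civita (j # k # l # I)"
    "levi_civita (j # l # k # I) = - levi_civita (j # k # l # I)"
    "levi_civita (l # k # j # I) = - levi_civita (j # k # l # I)"
    "levi_civita (k # l # j # I) = levi_civita (j # k # l # I)"
    "levi_civita (l # j # k # I) = levi_civita (j # k # l # I)" if "length I = r" for I
  proof -
    note s = levi_civita_swap3[of I, unfolded that, OF r]
    show "levi_civita (k # j # l # I) = - levi_civita (j # k # l # I)" by (rule s(1))
    show "levi_civita (j # l # k # I) = - levi_civita (j # k # l # I)" by (rule s(2))
    show "levi_civita (l # k # j # I) = - levi_civita (j # k # l # I)" by (rule s(3))
    show "levi_civita (k # l # j # I) = levi_civita (j # k # l # I)" using s(2)[of k l j] s(1)[of k j l] by linarith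
    show "levi_civita (l # j # k # I) = levi_civita (j # k # l # I)" using s(1)[of l j k] s(2)[of j l k] by linarith
  qed
  have ne: "j \<noteq> k" "j \<noteq> l" "k \<noteq> l" using True by auto
  have "i \<in> {j, k, l}" "m \<in> {j, k, l}" "n \<in> {j, k, l}" "i \<noteq> m" "i \<noteq> n" "m \<noteq> n"
    using True by auto
  then consider "i = j" "m = k" "n = l" | "i = k" "m = j" "n = l" | "i = j" "m = l" "n = k" | "i = l" "m = k" "n = j"
    | "i = k" "m = l" "n = j" | "i = l" "m = j" "n = k"
    by auto
  then show ?thesis
    using sq ne ne[symmetric] by cases (simp_all add: sw sum_negf kron3_def kron_def)
qed

text \<open>The component with index \<open>I\<close> of the Hodge dual of \<open>v \<and> a \<and> b\<close>.\<close>
definition levi_civita_form ::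
  "(real, 'm::{finite,linorder}) vec \<Rightarrow> (real, 'm) vec \<Rightarrow> (real, 'm) vec \<Rightarrow> 'm list \<Rightarrow> real" where
  "levi_civita_form v a b I =
    (\<Sum>j\<in>UNIV. \<Sum>k\<in>UNIV. \<Sum>l\<in>UNIV. levi_civita (j # k # l # I) * (v $ j * a $ k * b $ l))"

lemma levi_civita_form_swap:
  fixes I :: "'m::{finite,linorder} list"
  assumes "length I + 3 = CARD('m)"
  shows "levi_civita_form a v b I = - levi_civita_form v a b I"
    and "levi_civita_form v b a I = - levi_civita_form v a b I"
    and "levi_civita_form b a v I = - levi_civita_form v a b I"
proof -
  note s = levi_civita_swap3[OF assms]
  have 1: "levi_civita_form a v b I = - levi_civita_form v a b I" for v a b
    unfolding levi_civita_form_def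
    unfolding sum_negf[symmetric]
    by (subst sum.swap, intro sum.cong refl, subst s(1)) (simp add: mult_ac)
  have 2: "levi_civita_form v b a I = - levi_civita_form v a b I" for v a b
    unfolding levi_civita_form_def sum_negf[symmetric]
    by (rule sum.cong[OF refl], subst sum.swap, intro sum.cong refl, subst s(2)) (simp add: mult_ac)
  show "levi_civita_form a v b I = - levi_civita_form v a b I" by (rule 1)
  show "levi_civita_form v b a I = - levi_civita_form v a b I" by (rule 2)
  show "levi_civita_form b a v I = - levi_civita_form v a b I"
    using 1[of b a v] 2[of a b v] 1[of a v b] by simp
qed

lemma sum_product3:
  fixes f g q :: "_ \<Rightarrow> real"
  shows "(\<Sum>j\<in>A. f j) * (\<Sum>k\<in>B. g k) * (\<Sum>l\<in>C. q l) = (\<Sum>j\<in>A. \<Sum>k\<in>B. \<Sum>l\<in>C. f j * g k * q l)"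
  unfolding sum_product[of f A g B] unfolding sum_distrib_right unfolding sum_distrib_left ..

lemma kron3_apply:
  fixes v w :: "real^'m::finite"
  shows "(\<Sum>i\<in>UNIV. \<Sum>m\<in>UNIV. \<Sum>n\<in>UNIV. kron3 j k l i m n * (w $ i * a $ m * b $ n)) =
    w $ j * (a $ k * b $ l - a $ l * b $ k) - a $ j * (w $ k * b $ l - w $ l * b $ k)
    + b $ j * (w $ k * a $ l - w $ l * a $ k)"
proof -
  have d: "(\<Sum>i\<in>UNIV. \<Sum>m\<in>UNIV. \<Sum>n\<in>UNIV. kron p i * kron q m * kron s n * (w $ i * a $ m * b $ n))
    = w $ p * a $ q * b $ s" for p q s
  proof -
    have 1: "(\<Sum>i\<in>UNIV. kron p i * f i) = f p" for p and f :: "'m \<Rightarrow> real"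
      by (simp add: kron_def if_distrib[of "\<lambda>x. x * _"] cong: if_cong)
    have "(\<Sum>i\<in>UNIV. \<Sum>m\<in>UNIV. \<Sum>n\<in>UNIV. kron p i * kron q m * kron s n * (w $ i * a $ m * b $ n))
      = (\<Sum>i\<in>UNIV. kron p i * w $ i) * (\<Sum>m\<in>UNIV. kron q m * a $ m) * (\<Sum>n\<in>UNIV. kron s n * b $ n)"
      unfolding sum_product3 by (simp add: mult_ac)
    then show ?thesis by (simp add: 1)
  qed
  let ?K = "\<lambda>p q s i m n. kron p i * kron q m * kron s n * (w $ i * a $ m * b $ n)"
  have "(\<Sum>i\<in>UNIV. \<Sum>m\<in>UNIV. \<Sum>n\<in>UNIV. kron3 j k l i m n * (w $ i * a $ m * b $ n)) =
    (\<Sum>i\<in>UNIV. \<Sum>m\<in>UNIV. \<Sum>n\<in>UNIV. ?K j k l i m n - ?K j l k i m n - ?K k j l i m n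
      + ?K l j k i m n + ?K k l j i m n - ?K l k j i m n)"
    unfolding kron3_def by (intro sum.cong refl) (simp add: algebra_simps)
  also have "\<dots> = w $ j * a $ k * b $ l - w $ j * a $ l * b $ k - w $ k * a $ j * b $ l
    + w $ l * a $ j * b $ k + w $ k * a $ l * b $ j - w $ l * a $ k * b $ j"
    by (simp only: sum.distrib sum_subtractf d)
  finally have "(\<Sum>i\<in>UNIV. \<Sum>m\<in>UNIV. \<Sum>n\<in>UNIV. kron3 j k l i m n * (w $ i * a $ m * b $ n)) =
    w $ j * a $ k * b $ l - w $ j * a $ l * b $ k - w $ k * a $ j * b $ l
    + w $ l * a $ j * b $ k + w $ k * a $ l * b $ j - w $ l * a $ k * b $ j" .
  then show ?thesis by (simp add: algebra_simps)
qed

text \<open>The Hodge star is an isometry up to a combinatorial factor, so the sum is the Gram determinant of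
  \<open>v, a, b\<close> against \<open>w, a, b\<close>.\<close>
lemma levi_civita_form_contraction:
  fixes v w a b :: "(real, 'm::{finite,linorder}) vec"
  assumes r: "r + 3 = CARD('m)"
  shows "(\<Sum>I\<in>{I. length I = r}. levi_civita_form v a b I * levi_civita_form w a b I) = fact r *
    (((a \<bullet> a) * (b \<bullet> b) - (a \<bullet> b)\<^sup>2) * (v \<bullet> w)
     - ((b \<bullet> b) * (v \<bullet> a) * (w \<bullet> a) - (a \<bullet> b) * ((v \<bullet> a) * (w \<bullet> b) + (v \<bullet> b) * (w \<bullet> a))
        + (a \<bullet> a) * (v \<bullet> b) * (w \<bullet> b)))"
proof -
  let ?S = "{I :: 'm list. length I = r}"
  have sw: "(\<Sum>I\<in>?S. \<Sum>j\<in>UNIV. \<Sum>k\<in>UNIV. \<Sum>l\<in>UNIV. F j k l I) = (\<Sum>j\<in>UNIV. \<Sum>k\<in>UNIV. \<Sum>l\<in>UNIV. \<Sum>I\<in>?S. F j k l I)"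
    for F :: "'m \<Rightarrow> 'm \<Rightarrow> 'm \<Rightarrow> 'm list \<Rightarrow> real"
    by (simp only: sum.swap[of _ UNIV ?S])
  have inner: "(\<Sum>I\<in>?S. levi_civita (j # k # l # I) * levi_civita_form w a b I) = fact r *
    (w $ j * (a $ k * b $ l - a $ l * b $ k) - a $ j * (w $ k * b $ l - w $ l * b $ k)
    + b $ j * (w $ k * a $ l - w $ l * a $ k))" for j k l
  proof -
    have "(\<Sum>I\<in>?S. levi_civita (j # k # l # I) * levi_civita_form w a b I) =
      (\<Sum>i\<in>UNIV. \<Sum>m\<in>UNIV. \<Sum>n\<in>UNIV. (\<Sum>I\<in>?S. levi_civita (j # k # l # I) * levi_civita (i # m # n # I)) * (w $ i * a $ m * b $ n))"
      by (simp add: levi_civita_form_def sum_distrib_left sw sum_distrib_right mult.assoc)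
    also have "\<dots> = fact r * (\<Sum>i\<in>UNIV. \<Sum>m\<in>UNIV. \<Sum>n\<in>UNIV. kron3 j k l i m n * (w $ i * a $ m * b $ n))"
      by (simp add: levi_civita_contraction[OF r] sum_distrib_left mult.assoc)
    finally show ?thesis by (simp add: kron3_apply)
  qed
  have "(\<Sum>I\<in>?S. levi_civita_form v a b I * levi_civita_form w a b I) =
    (\<Sum>j\<in>UNIV. \<Sum>k\<in>UNIV. \<Sum>l\<in>UNIV. (v $ j * a $ k * b $ l) * (\<Sum>I\<in>?S. levi_civita (j # k # l # I) * levi_civita_form w a b I))"
    by (subst levi_civita_form_def) (simp add: sum_distrib_left sw sum_distrib_right mult_ac)
  also have "\<dots> = fact r * (\<Sum>j\<in>UNIV. \<Sum>k\<in>UNIV. \<Sum>l\<in>UNIV.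
      ((v $ j * w $ j) * (a $ k * a $ k) * (b $ l * b $ l) - (v $ j * w $ j) * (a $ k * b $ k) * (b $ l * a $ l)
      - (v $ j * a $ j) * (a $ k * w $ k) * (b $ l * b $ l) + (v $ j * a $ j) * (a $ k * b $ k) * (b $ l * w $ l)
      + (v $ j * b $ j) * (a $ k * w $ k) * (b $ l * a $ l) - (v $ j * b $ j) * (a $ k * a $ k) * (b $ l * w $ l)))"
    unfolding inner sum_distrib_left by (intro sum.cong refl) (simp add: algebra_simps)
  also have "\<dots> = fact r * (
      (v \<bullet> w) * (a \<bullet> a) * (b \<bullet> b) - (v \<bullet> w) * (a \<bullet> b) * (b \<bullet> a)
      - (v \<bullet> a) * (a \<bullet> w) * (b \<bullet> b) + (v \<bullet> a) * (a \<bullet> b) * (b \<bullet> w)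
      + (v \<bullet> b) * (a \<bullet> w) * (b \<bullet> a) - (v \<bullet> b) * (a \<bullet> a) * (b \<bullet> w))"
    unfolding sum.distrib sum_subtractf by (simp add: inner_vec_def sum_product3)
  finally show ?thesis
    by (simp add: inner_commute[of b a] inner_commute[of a w] inner_commute[of b w] algebra_simps power2_eq_square)
qed

section \<open>Curvature through normal frames and Poisson brackets\<close>

text \<open>The trace of the square of \<open>a \<otimes> \<alpha> - b \<otimes> \<beta>\<close>. Both \<open>\<S>\<^sub>A\<close> and the nested brackets have this shape, with
  \<open>\<alpha>\<close>, \<open>\<beta>\<close> the derivatives of a normal field.\<close>
lemma trace_square_rank_two:
  fixes a b \<alpha> \<beta> :: "real^'m::finite"
  shows "(\<Sum>i\<in>UNIV. \<Sum>j\<in>UNIV. (a $ i * \<alpha> $ j - b $ i * \<beta> $ j) * (a $ j * \<alpha> $ i - b $ j * \<beta> $ i))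
    = (\<alpha> \<bullet> a)\<^sup>2 - 2 * (\<alpha> \<bullet> b) * (\<beta> \<bullet> a) + (\<beta> \<bullet> b)\<^sup>2"
proof -
  have p: "(\<Sum>i\<in>UNIV. \<Sum>j\<in>UNIV. (v $ i * w $ i) * (y $ j * z $ j)) = (v \<bullet> w) * (y \<bullet> z)" for v w y z :: "real^'m"
    by (simp add: inner_vec_def sum_product)
  have "(\<Sum>i\<in>UNIV. \<Sum>j\<in>UNIV. (a $ i * \<alpha> $ j - b $ i * \<beta> $ j) * (a $ j * \<alpha> $ i - b $ j * \<beta> $ i)) =
    (\<Sum>i\<in>UNIV. \<Sum>j\<in>UNIV. (\<alpha> $ i * a $ i) * (\<alpha> $ j * a $ j) - (\<beta> $ i * a $ i) * (\<alpha> $ j * b $ j)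
      - (\<alpha> $ i * b $ i) * (\<beta> $ j * a $ j) + (\<beta> $ i * b $ i) * (\<beta> $ j * b $ j))"
    by (intro sum.cong refl) (simp add: algebra_simps)
  also have "\<dots> = (\<alpha> \<bullet> a) * (\<alpha> \<bullet> a) - (\<beta> \<bullet> a) * (\<alpha> \<bullet> b) - (\<alpha> \<bullet> b) * (\<beta> \<bullet> a) + (\<beta> \<bullet> b) * (\<beta> \<bullet> b)"
    by (simp only: sum.distrib sum_subtractf p)
  finally show ?thesis by (simp add: power2_eq_square)
qed

lemma sum_eps2: "(\<Sum>a\<in>UNIV. \<Sum>b\<in>UNIV. eps2 a b * f a * g b) = f 1 * g 2 - f 2 * g 1"
  by (simp add: eps2_def sum_2)

context immersed_patch
begin

text \<open>By a dimension count \<open>e\<^sub>1, e\<^sub>2\<close> and the \<open>N\<^sub>A\<close> form a basis, in which both sides can be computed.\<close>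
lemma normal_part_frame:
  fixes N :: "'p::finite \<Rightarrow> real^'m"
  assumes u: "u \<in> W" and dim: "CARD('m) = 2 + CARD('p)"
    and normal: "\<And>A a. ip u (N A) (e a u) = 0"
    and orthonormal: "\<And>A B. ip u (N A) (N B) = (if A = B then 1 else 0)"
  shows "normal_part u v w = (\<Sum>A\<in>UNIV. ip u v (N A) * ip u w (N A))"
proof -
  define L where "L = (\<lambda>(q :: real^2, \<beta> :: real^'p). q $ 1 *\<^sub>R e 1 u + q $ 2 *\<^sub>R e 2 u + (\<Sum>A\<in>UNIV. \<beta> $ A *\<^sub>R N A))"
  have lin: "linear L"
    by (intro linearI) (auto simp: L_def algebra_simps sum.distrib scaleR_sum_right)
  have normal': "ip u (e a u) (N A) = 0" for A a
    using normal ip_sym[OF u] by metis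
  have LN: "ip u (L (q, \<beta>)) (N A) = \<beta> $ A" for q \<beta> A
    by (simp add: L_def ip_add ip_scaleR ip_sum normal' orthonormal if_distrib[of "\<lambda>x. _ * x"] cong: if_cong)
  have "inj L"
  proof (rule linear_injective_0[OF lin, THEN iffD2], intro allI impI)
    fix z assume z: "L z = 0"
    obtain q \<beta> where zq: "z = (q, \<beta>)" by (cases z)
    have "\<beta> $ A = 0" for A using LN[of q \<beta> A] z zq by (simp add: metric_at_eq)
    then have "\<beta> = 0" by (simp add: vec_eq_iff)
    moreover have "q = 0"
      using e_independent[OF u, of "q $ 1" "q $ 2"] z zq \<open>\<beta> = 0\<close> by (simp add: L_def vec_eq_iff forall_2)
    ultimately show "z = 0" using zq by (simp add: zero_prod_def)
  qed
  then have "dim (range L) = DIM((real^2) \<times> (real^'p))"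
    using dim_image_eq[OF lin, of UNIV] by simp
  also have "\<dots> = DIM(real^'m)" using dim by simp
  finally have "range L = UNIV"
    using dim_eq_full[of "range L"] linear_subspace_image[OF lin subspace_UNIV]
    by (metis span_eq_iff)
  then obtain q \<beta> q' \<beta>' where v: "v = L (q, \<beta>)" and w: "w = L (q', \<beta>')" by (metis surj_def surj_pair)
  have Le: "ip u (L (q, \<beta>)) (e a u) = q $ 1 * h u $ 1 $ a + q $ 2 * h u $ 2 $ a" for q \<beta> a
    by (simp add: L_def ip_add ip_scaleR ip_sum normal h_nth)
  have LL: "ip u (L (q, \<beta>)) (L (q', \<beta>')) =
     q $ 1 * q' $ 1 * h u $ 1 $ 1 + (q $ 1 * q' $ 2 + q $ 2 * q' $ 1) * h u $ 1 $ 2 + q $ 2 * q' $ 2 * h u $ 2 $ 2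
     + (\<Sum>A\<in>UNIV. \<beta> $ A * \<beta>' $ A)"
  proof -
    have "ip u z (L (q', \<beta>')) = q' $ 1 * ip u z (e 1 u) + q' $ 2 * ip u z (e 2 u) + (\<Sum>A\<in>UNIV. \<beta>' $ A * ip u z (N A))" for z
      by (simp add: L_def ip_add ip_scaleR ip_sum)
    then show ?thesis by (simp add: Le LN h_sym[OF u] algebra_simps)
  qed
  have "(h u $ 2 $ 2 * ip u v (e 1 u) * ip u w (e 1 u)
     - h u $ 1 $ 2 * (ip u v (e 1 u) * ip u w (e 2 u) + ip u v (e 2 u) * ip u w (e 1 u))
     + h u $ 1 $ 1 * ip u v (e 2 u) * ip u w (e 2 u)) =
     (q $ 1 * q' $ 1 * h u $ 1 $ 1 + (q $ 1 * q' $ 2 + q $ 2 * q' $ 1) * h u $ 1 $ 2 + q $ 2 * q' $ 2 * h u $ 2 $ 2) * det (h u)"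
    by (simp add: v w Le h_sym[OF u] det_h[OF u] algebra_simps power2_eq_square)
  then show ?thesis
    using det_h_pos[OF u] by (simp add: normal_part_def v w LL LN)
qed

text \<open>Differentiating \<open>\<langle>N,e\<^sub>b\<rangle> = 0\<close>, for the members of a frame as well as for the fields \<open>Z\<^sub>I\<close> made of
  brackets.\<close>
lemma covd_normal:
  assumes u: "u \<in> W" and N: "N differentiable at u"
    and normal: "\<And>v. v \<in> W \<Longrightarrow> ip v (N v) (e b v) = 0"
  shows "ip u (covd a N u) (e b u) = - ip u (covd a (e b) u) (N u)"
proof -
  have "pd a (\<lambda>_. 0) u = pd a (\<lambda>v. ip v (N v) (e b v)) u"
    by (rule pd_cong[OF open_W u]) (auto simp: normal)
  then show ?thesis
    using metric_compat[OF u N smooth_diff[OF smooth_e u]] ip_sym[OF u, of "N u"] by simp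
qed

lemma nabla_along_covd:
  assumes u: "u \<in> W" and N: "N differentiable at u"
  shows "nabla_along G x a N u = covd a N u"
  using pd_vec_nth[OF N, of a] pd_vec_nth[OF smooth_diff[OF smooth_x u], of a]
  by (simp add: nabla_along_def covd_def vec_eq_iff chris_nth)

lemma S_up_eq:
  assumes u: "u \<in> W" and N: "N differentiable at u"
  shows "S_up G x \<rho> N u $ i $ j = (e 1 u $ i * covd 2 N u $ j - e 2 u $ i * covd 1 N u $ j) / \<rho> u"
  using pd_vec_nth[OF smooth_diff[OF smooth_x u]]
  by (simp add: S_up_def sum_eps2 nabla_along_covd[OF assms])

text \<open>The map \<open>\<S>\<^sub>A\<close> takes values in the tangent plane, where its matrix in the basis \<open>e\<^sub>1, e\<^sub>2\<close> is \<open>1/\<rho>\<close> times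
  the second fundamental form followed by a quarter turn. This matrix is trace free, so the trace of
  its square is \<open>-2\<close> times its determinant.\<close>
lemma trace_S_map_square:
  assumes u: "u \<in> W" and N: "smooth_on W N" and normal: "\<And>v a. v \<in> W \<Longrightarrow> ip v (N v) (e a v) = 0"
  shows "trace (S_map G x \<rho> N u ** S_map G x \<rho> N u) =
    - 2 * (ip u (covd 1 (e 1) u) (N u) * ip u (covd 2 (e 2) u) (N u) - (ip u (covd 1 (e 2) u) (N u))\<^sup>2) / (\<rho> u)\<^sup>2"
proof -
  have Nd: "N differentiable at u" by (rule smooth_diff[OF N u])
  define \<alpha> where "\<alpha> a = (\<chi> k. \<Sum>j\<in>UNIV. covd a N u $ j * G (x u) $ j $ k)" for a
  have \<alpha>: "\<alpha> a \<bullet> e b u = - ip u (covd a (e b) u) (N u)" for a b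
  proof -
    have "\<alpha> a \<bullet> e b u = ip u (covd a N u) (e b u)"
      by (simp add: \<alpha>_def inner_vec_def metric_at_def sum_distrib_right sum_distrib_left mult_ac) (rule sum.swap)
    also have "\<dots> = - ip u (covd a (e b) u) (N u)"
      by (rule covd_normal[OF u Nd normal])
    finally show ?thesis .
  qed
  have S: "S_map G x \<rho> N u $ i $ k = (e 1 u $ i * \<alpha> 2 $ k - e 2 u $ i * \<alpha> 1 $ k) / \<rho> u" for i k
    by (simp add: S_map_def S_up_eq[OF u Nd] \<alpha>_def sum_distrib_left sum_subtractf[symmetric] sum_divide_distrib algebra_simps diff_divide_distrib)
  have "trace (S_map G x \<rho> N u ** S_map G x \<rho> N u) =
    (\<Sum>i\<in>UNIV. \<Sum>k\<in>UNIV. (e 1 u $ i * \<alpha> 2 $ k - e 2 u $ i * \<alpha> 1 $ k) * (e 1 u $ k * \<alpha> 2 $ i - e 2 u $ k * \<alpha> 1 $ i)) / (\<rho> u)\<^sup>2"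
    by (simp add: trace_def matrix_matrix_mult_def S sum_divide_distrib power2_eq_square)
  then show ?thesis
    unfolding trace_square_rank_two \<alpha> using torsion_free[OF u, of 1 2] by (simp add: power2_eq_square algebra_simps)
qed

lemma curvature_via_S_map:
  fixes N :: "'p::finite \<Rightarrow> real^2 \<Rightarrow> real^'m"
  assumes u: "u \<in> W" and dim: "CARD('m) = 2 + CARD('p)" and N: "normal_frame G x W N" and \<rho>: "\<rho> u \<noteq> 0"
  shows "gaussian_curvature h u = ip u (curvature G (x u) (e 1 u) (e 2 u) (e 2 u)) (e 1 u) / det (h u)
     - 1 / (2 * gamma_factor G x \<rho> u ^ 2) * (\<Sum>A\<in>UNIV. trace (S_map G x \<rho> (N A) u ** S_map G x \<rho> (N A) u))"
proof -
  let ?II = "\<lambda>a b A. ip u (covd a (e b) u) (N A u)"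
  have frame: "normal_part u v w = (\<Sum>A\<in>UNIV. ip u v (N A u) * ip u w (N A u))" for v w
    using N u by (intro normal_part_frame dim) (auto simp: normal_frame_def)
  have tr: "trace (S_map G x \<rho> (N A) u ** S_map G x \<rho> (N A) u) =
    - 2 * (?II 1 1 A * ?II 2 2 A - (?II 1 2 A)\<^sup>2) / (\<rho> u)\<^sup>2" for A
    using N by (intro trace_S_map_square u) (auto simp: normal_frame_def)
  have \<gamma>: "gamma_factor G x \<rho> u ^ 2 = det (h u) / (\<rho> u)\<^sup>2"
    using det_h_pos[OF u] by (simp add: gamma_factor_def power_divide)
  have "(\<Sum>A\<in>UNIV. trace (S_map G x \<rho> (N A) u ** S_map G x \<rho> (N A) u)) =
    - 2 / (\<rho> u)\<^sup>2 * (\<Sum>A\<in>UNIV. ?II 1 1 A * ?II 2 2 A - (?II 1 2 A)\<^sup>2)"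
    unfolding tr sum_distrib_left by (simp only: times_divide_eq_left)
  also have "(\<Sum>A\<in>UNIV. ?II 1 1 A * ?II 2 2 A - (?II 1 2 A)\<^sup>2) =
    gaussian_curvature h u * det (h u) - ip u (curvature G (x u) (e 1 u) (e 2 u) (e 2 u)) (e 1 u)"
    by (simp add: gauss_equation[OF u] frame sum_subtractf power2_eq_square)
  finally show ?thesis
    using det_h_pos[OF u] \<rho> by (simp add: \<gamma> field_simps)
qed

end

lemma poisson_eq:
  "poisson \<rho> f g u = (pd 1 f u * pd 2 g u - pd 2 f u * pd 1 g u) / \<rho> u"
  by (simp add: poisson_def sum_eps2)

text \<open>Constant metric coefficients make the Christoffel symbols vanish, so covariant derivatives become
  partial derivatives.\<close>
locale euclidean_patch = immersed_patch "\<lambda>_. mat 1" V x W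
  for V :: "(real, 'm::{finite,linorder}) vec set" and x W
begin

lemma ip_inner: "ip u v w = v \<bullet> w"
  by (simp add: metric_at_eq)

lemma christoffel_zero: "christoffel (\<lambda>_. mat 1) i j k y = 0"
  by (simp add: christoffel_def)

lemma covd_eq_pd: "covd a Y u = pd a Y u"
  by (simp add: covd_def vec_eq_iff chris_nth christoffel_zero)

lemma curvature_zero: "u \<in> W \<Longrightarrow> curvature (\<lambda>_. mat 1) (x u) v w z = 0"
proof -
  have "chris_matrix (\<lambda>_. mat 1) i = (\<lambda>_. 0)" for i :: 'm
    by (simp add: chris_matrix_def christoffel_zero fun_eq_iff vec_eq_iff)
  moreover have "frechet_derivative (\<lambda>_. 0 :: ((real, 'm) vec, 'm) vec) (at y) = (\<lambda>_. 0)" for y :: "(real, 'm) vec"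
    by (rule frechet_derivative_at[OF has_derivative_const, symmetric])
  ultimately show "u \<in> W \<Longrightarrow> ?thesis"
    by (simp add: curvature_eq[OF x_in_V] vec_eq_iff chris_nth christoffel_zero)
qed

lemma trace_S_map_poisson:
  assumes u: "u \<in> W" and N: "N differentiable at u"
  shows "trace (S_map (\<lambda>_. mat 1) x \<rho> N u ** S_map (\<lambda>_. mat 1) x \<rho> N u) =
    (\<Sum>i\<in>UNIV. \<Sum>j\<in>UNIV. poisson \<rho> (\<lambda>v. x v $ i) (\<lambda>v. N v $ j) u * poisson \<rho> (\<lambda>v. x v $ j) (\<lambda>v. N v $ i) u)"
proof -
  have "S_map (\<lambda>_. mat 1) x \<rho> N u $ i $ k = S_up (\<lambda>_. mat 1) x \<rho> N u $ i $ k" for i k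
    by (simp add: S_map_def mat_def if_distrib[of "\<lambda>x. _ * x"] cong: if_cong)
  moreover have "S_up (\<lambda>_. mat 1) x \<rho> N u $ i $ j = poisson \<rho> (\<lambda>v. x v $ i) (\<lambda>v. N v $ j) u" for i j
    using pd_vec_nth[OF N] pd_vec_nth[OF smooth_diff[OF smooth_x u]]
    by (simp add: S_up_eq[OF u N] poisson_eq covd_eq_pd)
  ultimately show ?thesis by (simp add: trace_def matrix_matrix_mult_def)
qed

lemma curvature_via_poisson:
  fixes N :: "'p::finite \<Rightarrow> real^2 \<Rightarrow> (real, 'm) vec"
  assumes u: "u \<in> W" and dim: "CARD('m) = 2 + CARD('p)" and N: "normal_frame (\<lambda>_. mat 1) x W N" and \<rho>: "\<rho> u \<noteq> 0"
  shows "gaussian_curvature h u = - 1 / (2 * gamma_factor (\<lambda>_. mat 1) x \<rho> u ^ 2) *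
    (\<Sum>A\<in>UNIV. \<Sum>i\<in>UNIV. \<Sum>j\<in>UNIV. poisson \<rho> (\<lambda>v. x v $ i) (\<lambda>v. N A v $ j) u * poisson \<rho> (\<lambda>v. x v $ j) (\<lambda>v. N A v $ i) u)"
proof -
  have "N A differentiable at u" for A
    using N u by (intro smooth_diff) (auto simp: normal_frame_def)
  then show ?thesis
    using curvature_via_S_map[where N=N and \<rho>=\<rho>, OF u dim N \<rho>]
    by (simp add: curvature_zero[OF u] trace_S_map_poisson[OF u] ip_inner)
qed

lemma normal_part_contraction:
  assumes u: "u \<in> W" and r: "r + 3 = CARD('m)"
  shows "(\<Sum>I\<in>{I. length I = r}. levi_civita_form v (e 1 u) (e 2 u) I * levi_civita_form w (e 1 u) (e 2 u) I)
    = fact r * det (h u) * normal_part u v w"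
proof -
  have "det (h u) * normal_part u v w = det (h u) * (v \<bullet> w) -
    (h u $ 2 $ 2 * (v \<bullet> e 1 u) * (w \<bullet> e 1 u)
     - h u $ 1 $ 2 * ((v \<bullet> e 1 u) * (w \<bullet> e 2 u) + (v \<bullet> e 2 u) * (w \<bullet> e 1 u))
     + h u $ 1 $ 1 * (v \<bullet> e 2 u) * (w \<bullet> e 2 u))"
    using det_h_pos[OF u] by (simp add: normal_part_def ip_inner right_diff_distrib)
  then show ?thesis
    unfolding mult.assoc[of "fact r"]
    by (simp add: levi_civita_form_contraction[OF r] h_nth det_h[OF u] ip_inner)
qed

text \<open>The field \<open>Z\<^sub>I\<close>: up to the factor \<open>2/\<rho>\<close>, the Hodge dual of \<open>e\<^sub>1 \<and> e\<^sub>2\<close> contracted with the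
  multi-index \<open>I\<close>. It is a normal field given by the
  embedding and the density, in contrast to a normal frame.\<close>
definition bracket_normal :: "(real^2 \<Rightarrow> real) \<Rightarrow> 'm list \<Rightarrow> real^2 \<Rightarrow> (real, 'm) vec" where
  "bracket_normal \<rho> I v = (\<chi> j. \<Sum>k\<in>UNIV. \<Sum>l\<in>UNIV. levi_civita (j # k # l # I) * poisson \<rho> (\<lambda>v. x v $ k) (\<lambda>v. x v $ l) v)"

lemma poisson_x:
  "v \<in> W \<Longrightarrow> poisson \<rho> (\<lambda>v. x v $ k) (\<lambda>v. x v $ l) v = (e 1 v $ k * e 2 v $ l - e 2 v $ k * e 1 v $ l) / \<rho> v"
  using pd_vec_nth[OF smooth_diff[OF smooth_x]] by (simp add: poisson_eq)

lemma poisson_x_differentiable: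
  assumes u: "u \<in> W" and \<rho>: "smooth_on W \<rho>" "\<rho> u \<noteq> 0"
  shows "poisson \<rho> (\<lambda>v. x v $ k) (\<lambda>v. x v $ l) differentiable at u"
  unfolding poisson_eq[abs_def]
  using \<rho>(2)
  by (intro differentiable_divide differentiable_diff differentiable_mult smooth_diff[OF _ u] \<rho>(1)
      smooth_on_pd smooth_on_vec_nth open_W smooth_x)

lemma bracket_normal_inner:
  assumes v: "v \<in> W" and I: "length I + 3 = CARD('m)"
  shows "bracket_normal \<rho> I v \<bullet> y = 2 / \<rho> v * levi_civita_form y (e 1 v) (e 2 v) I"
proof -
  have "bracket_normal \<rho> I v \<bullet> y =
    (levi_civita_form y (e 1 v) (e 2 v) I - levi_civita_form y (e 2 v) (e 1 v) I) / \<rho> v"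
    unfolding levi_civita_form_def sum_subtractf[symmetric]
    by (simp add: bracket_normal_def inner_vec_def poisson_x[OF v] sum_distrib_left sum_distrib_right sum_divide_distrib
        diff_divide_distrib algebra_simps)
  then show ?thesis by (simp add: levi_civita_form_swap(2)[OF I, of y "e 2 v" "e 1 v"])
qed

lemma bracket_normal_is_normal:
  assumes v: "v \<in> W" and I: "length I + 3 = CARD('m)"
  shows "bracket_normal \<rho> I v \<bullet> e a v = 0"
proof -
  have "levi_civita_form (e a v) (e 1 v) (e 2 v) I = 0"
    using exhaust_2[of a] levi_civita_form_swap(1)[OF I, of "e 1 v" "e 1 v" "e 2 v"]
      levi_civita_form_swap(3)[OF I, of "e 2 v" "e 1 v" "e 2 v"] by auto
  then show ?thesis by (simp add: bracket_normal_inner[OF assms])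
qed

lemma bracket_normal_differentiable:
  assumes u: "u \<in> W" and \<rho>: "smooth_on W \<rho>" "\<rho> u \<noteq> 0"
  shows "bracket_normal \<rho> I differentiable at u"
  unfolding bracket_normal_def[abs_def]
  by (intro differentiable_vec_lambda differentiable_sum differentiable_mult differentiable_const
      poisson_x_differentiable assms ballI) auto

lemma poisson_bracket_normal:
  assumes u: "u \<in> W" and \<rho>: "smooth_on W \<rho>" "\<rho> u \<noteq> 0"
  shows "(\<Sum>k\<in>UNIV. \<Sum>l\<in>UNIV. levi_civita (j # k # l # I) * poisson \<rho> (\<lambda>v. x v $ i) (poisson \<rho> (\<lambda>v. x v $ k) (\<lambda>v. x v $ l)) u)
    = (e 1 u $ i * pd 2 (bracket_normal \<rho> I) u $ j - e 2 u $ i * pd 1 (bracket_normal \<rho> I) u $ j) / \<rho> u"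
proof -
  note d = poisson_x_differentiable[OF assms]
  have "pd a (bracket_normal \<rho> I) u $ j =
    (\<Sum>k\<in>UNIV. \<Sum>l\<in>UNIV. levi_civita (j # k # l # I) * pd a (poisson \<rho> (\<lambda>v. x v $ k) (\<lambda>v. x v $ l)) u)" for a
  proof -
    have "pd a (bracket_normal \<rho> I) u $ j = pd a (\<lambda>v. bracket_normal \<rho> I v $ j) u"
      by (rule pd_vec_nth[symmetric]) (rule bracket_normal_differentiable[OF assms])
    also have "\<dots> = (\<Sum>k\<in>UNIV. \<Sum>l\<in>UNIV. levi_civita (j # k # l # I) * pd a (poisson \<rho> (\<lambda>v. x v $ k) (\<lambda>v. x v $ l)) u)"
      unfolding bracket_normal_def
      by (simp add: pd_sum differentiable_sum differentiable_mult d pd_bilinear[OF bounded_bilinear_mult])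
    finally show ?thesis .
  qed
  then show ?thesis
    unfolding poisson_eq[of \<rho> "\<lambda>v. x v $ i"]
    using pd_vec_nth[OF smooth_diff[OF smooth_x u]]
    by (simp add: sum_distrib_left sum_distrib_right sum_divide_distrib sum_subtractf[symmetric] diff_divide_distrib algebra_simps)
qed

text \<open>The analogue of \<open>trace_S_map_square\<close> for the normal fields \<open>Z\<^sub>I\<close>.\<close>
lemma bracket_normal_trace:
  assumes u: "u \<in> W" and \<rho>: "smooth_on W \<rho>" "\<rho> u \<noteq> 0" and I: "length I + 3 = CARD('m)"
  defines "Q \<equiv> \<lambda>a b. levi_civita_form (pd a (e b) u) (e 1 u) (e 2 u) I"
  shows "(\<Sum>i\<in>UNIV. \<Sum>j\<in>UNIV.
     (\<Sum>k\<in>UNIV. \<Sum>l\<in>UNIV. levi_civita (j # k # l # I) * poisson \<rho> (\<lambda>v. x v $ i) (poisson \<rho> (\<lambda>v. x v $ k) (\<lambda>v. x v $ l)) u) *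
     (\<Sum>k\<in>UNIV. \<Sum>l\<in>UNIV. levi_civita (i # k # l # I) * poisson \<rho> (\<lambda>v. x v $ j) (poisson \<rho> (\<lambda>v. x v $ k) (\<lambda>v. x v $ l)) u))
    = 8 / \<rho> u ^ 4 * (Q 1 2 * Q 1 2 - Q 1 1 * Q 2 2)"
proof -
  let ?Z = "bracket_normal \<rho> I"
  have Z: "pd a ?Z u \<bullet> e b u = - (2 / \<rho> u * Q a b)" for a b
    using covd_normal[OF u bracket_normal_differentiable[OF u \<rho>], of I b a]
    by (simp add: ip_inner covd_eq_pd bracket_normal_is_normal[OF _ I] inner_commute[of "pd a (e b) u"]
        bracket_normal_inner[OF u I] Q_def)
  have "Q 2 1 = Q 1 2" using pd_commute[OF open_W u smooth_x, of 2 1] by (simp add: Q_def)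
  moreover have "(\<Sum>i\<in>UNIV. \<Sum>j\<in>UNIV.
     ((e 1 u $ i * pd 2 ?Z u $ j - e 2 u $ i * pd 1 ?Z u $ j) / \<rho> u) *
     ((e 1 u $ j * pd 2 ?Z u $ i - e 2 u $ j * pd 1 ?Z u $ i) / \<rho> u)) =
     ((pd 2 ?Z u \<bullet> e 1 u)\<^sup>2 - 2 * (pd 2 ?Z u \<bullet> e 2 u) * (pd 1 ?Z u \<bullet> e 1 u) + (pd 1 ?Z u \<bullet> e 2 u)\<^sup>2) / (\<rho> u)\<^sup>2"
    unfolding trace_square_rank_two[symmetric] by (simp add: sum_divide_distrib power2_eq_square)
  ultimately show ?thesis
    unfolding poisson_bracket_normal[OF u \<rho>] Z using \<rho>(2)
    by (simp add: field_simps power2_eq_square power4_eq_xxxx)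
qed

text \<open>Summed over \<open>I\<close>, the determinants of the second fundamental forms in the directions \<open>Z\<^sub>I\<close> contract to
  the normal parts in the Gauss equation.\<close>
lemma curvature_via_nested_poisson:
  assumes u: "u \<in> W" and \<rho>: "smooth_on W \<rho>" "\<rho> u \<noteq> 0" and r: "r + 3 = CARD('m)"
  shows "gaussian_curvature h u = - 1 / (8 * gamma_factor (\<lambda>_. mat 1) x \<rho> u ^ 4 * fact r) *
     (\<Sum>i\<in>UNIV. \<Sum>j\<in>UNIV. \<Sum>k\<in>UNIV. \<Sum>l\<in>UNIV. \<Sum>m\<in>UNIV. \<Sum>n\<in>UNIV. \<Sum>I\<in>{I. length I = r}.
         levi_civita (j # k # l # I) * levi_civita (i # m # n # I) *
         poisson \<rho> (\<lambda>v. x v $ i) (poisson \<rho> (\<lambda>v. x v $ k) (\<lambda>v. x v $ l)) u *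
         poisson \<rho> (\<lambda>v. x v $ j) (poisson \<rho> (\<lambda>v. x v $ m) (\<lambda>v. x v $ n)) u)"
    (is "_ = _ * ?sum")
proof -
  let ?S = "{I :: 'm list. length I = r}"
  let ?T = "\<lambda>i k l. poisson \<rho> (\<lambda>v. x v $ i) (poisson \<rho> (\<lambda>v. x v $ k) (\<lambda>v. x v $ l)) u"
  let ?Q = "\<lambda>a b I. levi_civita_form (pd a (e b) u) (e 1 u) (e 2 u) I"
  have "?sum = (\<Sum>I\<in>?S. \<Sum>i\<in>UNIV. \<Sum>j\<in>UNIV. \<Sum>k\<in>UNIV. \<Sum>l\<in>UNIV. \<Sum>m\<in>UNIV. \<Sum>n\<in>UNIV.
         levi_civita (j # k # l # I) * levi_civita (i # m # n # I) * ?T i k l * ?T j m n)"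
    by (simp only: sum.swap[of _ ?S UNIV])
  also have "\<dots> = (\<Sum>I\<in>?S. \<Sum>i\<in>UNIV. \<Sum>j\<in>UNIV.
      (\<Sum>k\<in>UNIV. \<Sum>l\<in>UNIV. levi_civita (j # k # l # I) * ?T i k l) *
      (\<Sum>k\<in>UNIV. \<Sum>l\<in>UNIV. levi_civita (i # k # l # I) * ?T j k l))"
    by (intro sum.cong refl, unfold sum_distrib_right, unfold sum_distrib_left, intro sum.cong refl)
      (simp add: mult_ac)
  also have "\<dots> = (\<Sum>I\<in>?S. 8 / \<rho> u ^ 4 * (?Q 1 2 I * ?Q 1 2 I - ?Q 1 1 I * ?Q 2 2 I))"
    using r by (intro sum.cong refl bracket_normal_trace[OF u \<rho>]) simp
  also have "\<dots> = 8 / \<rho> u ^ 4 * (fact r * det (h u) *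
      (normal_part u (pd 1 (e 2) u) (pd 1 (e 2) u) - normal_part u (pd 1 (e 1) u) (pd 2 (e 2) u)))"
    unfolding sum_distrib_left[symmetric] sum_subtractf normal_part_contraction[OF u r]
    by (simp only: right_diff_distrib)
  also have "\<dots> = - 8 / \<rho> u ^ 4 * fact r * det (h u) * (gaussian_curvature h u * det (h u))"
    by (simp add: gauss_equation[OF u] curvature_zero[OF u] ip_inner covd_eq_pd algebra_simps)
  finally have sum: "?sum = - 8 / \<rho> u ^ 4 * fact r * det (h u) * (gaussian_curvature h u * det (h u))" .
  have \<gamma>: "gamma_factor (\<lambda>_. mat 1) x \<rho> u ^ 4 = (det (h u))\<^sup>2 / \<rho> u ^ 4"
  proof -
    have "sqrt (det (h u)) ^ 4 = (sqrt (det (h u)) ^ 2) ^ 2" by (simp flip: power_mult)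
    then show ?thesis using det_h_pos[OF u] by (simp add: gamma_factor_def power_divide)
  qed
  show ?thesis
    unfolding sum \<gamma> using det_h_pos[OF u] \<rho>(2) by (simp add: field_simps power2_eq_square)
qed

end

section \<open>The theorem for embedded surfaces\<close>

text \<open>The inverse chart is a choice function, so this needs the chart to be injective on its domain.\<close>
lemma coord_map_in_chart:
  fixes b :: "('s, 'k::finite) chart" and c :: "('a, 'n::finite) chart"
  assumes "chart_on S b" "u \<in> coord_dom f b c"
  shows "coord_map f b c u \<in> snd c ` fst c"
proof -
  have "inj_on (snd b) (topspace (subtopology S (fst b)))"
    using assms(1) by (auto simp: chart_on_def dest: homeomorphic_imp_injective_map)
  moreover have "topspace (subtopology S (fst b)) = fst b"
    using assms(1) by (auto simp: chart_on_def dest: openin_subset)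
  ultimately have "chart_inv b (snd b q) = q" if "q \<in> fst b" for q
    using that by (cases b) simp
  then show ?thesis using assms(2) by (auto simp: coord_dom_def coord_map_def)
qed

theorem mainTheorem5:
  fixes X :: "'a topology" and \<A> :: "('a, 'm::{finite,linorder}) chart set"
    and gbar :: "('a, 'm) chart \<Rightarrow> (real, 'm) vec \<Rightarrow> ((real, 'm) vec, 'm) vec"
    and S :: "'s topology" and \<B> :: "('s, 2) chart set" and f :: "'s \<Rightarrow> 'a"
    and c :: "('a, 'm) chart" and b :: "('s, 2) chart"
    and G :: "(real, 'm) vec \<Rightarrow> ((real, 'm) vec, 'm) vec" and x :: "real^2 \<Rightarrow> (real, 'm) vec"
    and W :: "(real^2) set" and \<rho> :: "real^2 \<Rightarrow> real" and u :: "real^2"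
  assumes dim: "CARD('m) = 2 + CARD('p::finite)"
    and M: "smooth_manifold X \<A>" "riemannian_metric \<A> gbar"
    and \<Sigma>: "smooth_manifold S \<B>" "smooth_embedding S \<B> X \<A> f"
    and coords: "c \<in> \<A>" "b \<in> \<B>"
    and G: "G = gbar c" and x: "x = coord_map f b c"
    and W: "open W" "W \<subseteq> coord_dom f b c" "u \<in> W"
    and density: "smooth_on W \<rho>" "\<forall>v\<in>W. \<rho> v \<noteq> 0"
  shows
    "(\<forall>N :: 'p \<Rightarrow> real^2 \<Rightarrow> (real, 'm) vec. normal_frame G x W N \<longrightarrow>
        gaussian_curvature (induced_metric G x) u =
          metric_at G (x u) (curvature G (x u) (pd 1 x u) (pd 2 x u) (pd 2 x u)) (pd 1 x u)
            / det (induced_metric G x u)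
          - 1 / (2 * gamma_factor G x \<rho> u ^ 2) *
            (\<Sum>A\<in>UNIV. trace (S_map G x \<rho> (N A) u ** S_map G x \<rho> (N A) u)))
     \<and> (cartesian_coordinates X gbar c \<longrightarrow>
        (\<forall>N :: 'p \<Rightarrow> real^2 \<Rightarrow> (real, 'm) vec. normal_frame G x W N \<longrightarrow>
          gaussian_curvature (induced_metric G x) u =
            - 1 / (2 * gamma_factor G x \<rho> u ^ 2) *
              (\<Sum>A\<in>UNIV. \<Sum>i\<in>UNIV. \<Sum>j\<in>UNIV.
                 poisson \<rho> (\<lambda>v. x v $ i) (\<lambda>v. N A v $ j) u *
                 poisson \<rho> (\<lambda>v. x v $ j) (\<lambda>v. N A v $ i) u))
        \<and> gaussian_curvature (induced_metric G x) u =
            - 1 / (8 * gamma_factor G x \<rho> u ^ 4 * fact (CARD('p) - 1)) *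
              (\<Sum>i\<in>UNIV. \<Sum>j\<in>UNIV. \<Sum>k\<in>UNIV. \<Sum>l\<in>UNIV. \<Sum>m\<in>UNIV. \<Sum>n\<in>UNIV.
               \<Sum>I\<in>{I. length I = CARD('p) - 1}.
                 levi_civita (j # k # l # I) * levi_civita (i # m # n # I) *
                 poisson \<rho> (\<lambda>v. x v $ i) (poisson \<rho> (\<lambda>v. x v $ k) (\<lambda>v. x v $ l)) u *
                 poisson \<rho> (\<lambda>v. x v $ j) (poisson \<rho> (\<lambda>v. x v $ m) (\<lambda>v. x v $ n)) u)
        \<and> (CARD('p) = 1 \<and> (\<forall>v\<in>W. \<rho> v = sqrt (det (induced_metric G x v))) \<longrightarrow>
            (\<forall>n. normal_frame G x W (\<lambda>_ :: 'p. n) \<longrightarrow>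
              gaussian_curvature (induced_metric G x) u =
                - 1 / 2 * (\<Sum>i\<in>UNIV. \<Sum>j\<in>UNIV.
                   poisson \<rho> (\<lambda>v. x v $ i) (\<lambda>v. n v $ j) u *
                   poisson \<rho> (\<lambda>v. x v $ j) (\<lambda>v. n v $ i) u))))"
proof -
  let ?V = "snd c ` fst c"
  interpret immersed_patch G ?V x W
  proof
    show "open ?V" using M(1) coords(1) by (auto simp: smooth_manifold_def chart_on_def)
    show "smooth_on ?V G" "\<And>y. y \<in> ?V \<Longrightarrow> transpose (G y) = G y"
      "\<And>y v. y \<in> ?V \<Longrightarrow> v \<noteq> 0 \<Longrightarrow> 0 < metric_at G y v v"
      using M(2) coords(1) by (auto simp: riemannian_metric_def G)
    show "open W" by (rule W(1))
    show "smooth_on W x" "\<And>u. u \<in> W \<Longrightarrow> inj (frechet_derivative x (at u))"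
      using \<Sigma>(2) coords W(2) smooth_on_subset unfolding smooth_embedding_def x by blast+
    show "x u \<in> ?V" if "u \<in> W" for u
      unfolding x using \<Sigma>(1) coords(2) W(2) that
      by (intro coord_map_in_chart[of S]) (auto simp: smooth_manifold_def)
  qed
  have \<rho>: "\<rho> u \<noteq> 0" using density(2) W(3) by blast
  have cartesian: "euclidean_patch ?V x W \<and> G = (\<lambda>_. mat 1)" if "cartesian_coordinates X gbar c"
  proof -
    have "G = (\<lambda>_. mat 1)" using that by (auto simp: cartesian_coordinates_def G)
    then show ?thesis using immersed_patch_axioms by (simp add: euclidean_patch_def)
  qed
  have r: "(CARD('p) - 1) + 3 = CARD('m)"
    using dim zero_less_card_finite[where 'a='p] by linarith
  have second: "gaussian_curvature h u = - 1 / (2 * gamma_factor G x \<rho> u ^ 2) *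
      (\<Sum>A\<in>UNIV. \<Sum>i\<in>UNIV. \<Sum>j\<in>UNIV.
         poisson \<rho> (\<lambda>v. x v $ i) (\<lambda>v. N A v $ j) u * poisson \<rho> (\<lambda>v. x v $ j) (\<lambda>v. N A v $ i) u)"
    if "cartesian_coordinates X gbar c" "normal_frame G x W N" for N :: "'p \<Rightarrow> real^2 \<Rightarrow> (real, 'm) vec"
    using cartesian[OF that(1)] that(2) euclidean_patch.curvature_via_poisson[of ?V x W u N \<rho>] W(3) dim \<rho> by auto
  have third: "gaussian_curvature h u =
            - 1 / (8 * gamma_factor G x \<rho> u ^ 4 * fact (CARD('p) - 1)) *
              (\<Sum>i\<in>UNIV. \<Sum>j\<in>UNIV. \<Sum>k\<in>UNIV. \<Sum>l\<in>UNIV. \<Sum>m\<in>UNIV. \<Sum>n\<in>UNIV.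
               \<Sum>I\<in>{I. length I = CARD('p) - 1}.
                 levi_civita (j # k # l # I) * levi_civita (i # m # n # I) *
                 poisson \<rho> (\<lambda>v. x v $ i) (poisson \<rho> (\<lambda>v. x v $ k) (\<lambda>v. x v $ l)) u *
                 poisson \<rho> (\<lambda>v. x v $ j) (poisson \<rho> (\<lambda>v. x v $ m) (\<lambda>v. x v $ n)) u)"
    if "cartesian_coordinates X gbar c"
    using cartesian[OF that] euclidean_patch.curvature_via_nested_poisson[of ?V x W u \<rho>, OF _ W(3) density(1) \<rho> r] by auto
  have fourth: "gaussian_curvature h u = - 1 / 2 * (\<Sum>i\<in>UNIV. \<Sum>j\<in>UNIV.
                   poisson \<rho> (\<lambda>v. x v $ i) (\<lambda>v. n v $ j) u * poisson \<rho> (\<lambda>v. x v $ j) (\<lambda>v. n v $ i) u)"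
    if "cartesian_coordinates X gbar c" "CARD('p) = 1" "\<forall>v\<in>W. \<rho> v = sqrt (det (h v))"
      "normal_frame G x W (\<lambda>_ :: 'p. n)" for n
  proof -
    have "gamma_factor G x \<rho> u = 1"
      using that(3) W(3) det_h_pos[OF W(3)] by (simp add: gamma_factor_def)
    with second[OF that(1,4)] that(2) show ?thesis by simp
  qed
  have first: "gaussian_curvature h u =
          ip u (curvature G (x u) (e 1 u) (e 2 u) (e 2 u)) (e 1 u) / det (h u)
          - 1 / (2 * gamma_factor G x \<rho> u ^ 2) *
            (\<Sum>A\<in>UNIV. trace (S_map G x \<rho> (N A) u ** S_map G x \<rho> (N A) u))"
    if "normal_frame G x W N" for N :: "'p \<Rightarrow> real^2 \<Rightarrow> (real, 'm) vec"
    by (rule curvature_via_S_map[where N=N and \<rho>=\<rho>, OF W(3) dim that \<rho>])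
  show ?thesis
    using first second third fourth by blast
qed

end
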